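(* Let $G$ be a finite group of order $n$, let $d_1,\dots,d_s$ be the dimensions of the irreducible complex representations of $G$ (one for each isomorphism class), and let $$T_G=\sum_{\substack{g,h,k\in G\\ ghk=1}} g\otimes h\otimes k\in\mathbb{C}G\otimes\mathbb{C}G\otimes\mathbb{C}G.$$ Then $\|T_G\|_\star=\sqrt{n}\sum_{i=1}^s d_i^{5/2}$ and $[T_G]=\sqrt{n}$.
   Context: The group algebra $\mathbb{C}G$ is the Hilbert space with orthonormal basis the elements $g\in G$. For a tensor product $V=V^{(1)}\otimes\cdots\otimes V^{(d)}$ of finite dimensional Hilbert spaces (with the induced Hermitian form), a pure tensor is an element of the form $v^{(1)}\otimes\cdots\otimes v^{(d)}$ with $v^{(e)}\in V^{(e)}$. The nuclear norm $\|T\|_\star$ of $T\in V$ is the smallest possible value of $\sum_{i=1}^m\|v_i\|$ over all decompositions $T=\sum_{i=1}^m v_i$ ($m$ arbitrary) into pure tensors. The spectral norm $[T]$ is the maximum of $|\langle T,u\rangle|$ over all pure tensors $u\in V$ of unit length. *)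

theory Defs
  imports
    Complex_Main
    "HOL-Algebra.Coset"
    "Jordan_Normal_Form.VS_Connect"
begin

section \<open>Finite-dimensional Hilbert spaces with a fixed orthonormal basis\<close>

text \<open>
  The Hilbert space with orthonormal basis a finite set \<open>A\<close> is realised by coordinates, as the
  complex functions vanishing outside \<open>A\<close>. The group algebra of \<open>G\<close> is \<open>l2 (carrier G)\<close>.
  The form is linear in the first argument.
\<close>

definition l2 :: "'i set \<Rightarrow> ('i \<Rightarrow> complex) set" where
  "l2 A = {x. \<forall>a. a \<notin> A \<longrightarrow> x a = 0}"

definition l2_inner :: "'i set \<Rightarrow> ('i \<Rightarrow> complex) \<Rightarrow> ('i \<Rightarrow> complex) \<Rightarrow> complex" where
  "l2_inner A x y = (\<Sum>a\<in>A. x a * cnj (y a))"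

definition l2_norm :: "'i set \<Rightarrow> ('i \<Rightarrow> complex) \<Rightarrow> real" where
  "l2_norm A x = sqrt (\<Sum>a\<in>A. (cmod (x a))\<^sup>2)"

definition basis_vec :: "'i \<Rightarrow> 'i \<Rightarrow> complex" where
  "basis_vec g = (\<lambda>a. if a = g then 1 else 0)"

section \<open>Threefold tensor products\<close>

text \<open>
  The elements \<open>a \<otimes> b \<otimes> c\<close> form an orthonormal basis of the tensor product of \<open>l2 A\<close>,
  \<open>l2 B\<close>, \<open>l2 C\<close>, which is therefore \<open>l2 (A \<times> B \<times> C)\<close>; its form is the induced one
  by \<open>l2_inner_tensor3\<close> below.
\<close>

definition tensor3 ::
  "('a \<Rightarrow> complex) \<Rightarrow> ('b \<Rightarrow> complex) \<Rightarrow> ('c \<Rightarrow> complex) \<Rightarrow> 'a \<times> 'b \<times> 'c \<Rightarrow> complex" where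
  "tensor3 x y z = (\<lambda>(a, b, c). x a * y b * z c)"

lemma l2_inner_tensor3:
  "l2_inner (A \<times> B \<times> C) (tensor3 x y z) (tensor3 x' y' z') =
     l2_inner A x x' * l2_inner B y y' * l2_inner C z z'"
proof -
  have "l2_inner (A \<times> B \<times> C) (tensor3 x y z) (tensor3 x' y' z') =
      (\<Sum>a\<in>A. \<Sum>b\<in>B. \<Sum>c\<in>C. (x a * cnj (x' a)) * ((y b * cnj (y' b)) * (z c * cnj (z' c))))"
    unfolding l2_inner_def tensor3_def
    by (simp add: sum.cartesian_product mult_ac case_prod_unfold)
  also have "\<dots> = l2_inner A x x' * l2_inner B y y' * l2_inner C z z'"
    unfolding l2_inner_def
    by (simp add: sum_distrib_left[symmetric] sum_distrib_right[symmetric])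
  finally show ?thesis .
qed

definition pure_tensors :: "'a set \<Rightarrow> 'b set \<Rightarrow> 'c set \<Rightarrow> ('a \<times> 'b \<times> 'c \<Rightarrow> complex) set" where
  "pure_tensors A B C = {tensor3 x y z | x y z. x \<in> l2 A \<and> y \<in> l2 B \<and> z \<in> l2 C}"

text \<open>
  \<open>LEAST\<close> and \<open>GREATEST\<close> (rather than \<open>Inf\<close> and \<open>Sup\<close>) because the norms are a smallest and a
  largest value: both are unspecified unless the value is attained.
\<close>

definition nuclear_norm ::
  "'a set \<Rightarrow> 'b set \<Rightarrow> 'c set \<Rightarrow> ('a \<times> 'b \<times> 'c \<Rightarrow> complex) \<Rightarrow> real" where
  "nuclear_norm A B C T =
     (LEAST r. \<exists>(m::nat) v. (\<forall>i<m. v i \<in> pure_tensors A B C) \<and>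
        T = (\<lambda>t. \<Sum>i<m. v i t) \<and> r = (\<Sum>i<m. l2_norm (A \<times> B \<times> C) (v i)))"

definition spectral_norm ::
  "'a set \<Rightarrow> 'b set \<Rightarrow> 'c set \<Rightarrow> ('a \<times> 'b \<times> 'c \<Rightarrow> complex) \<Rightarrow> real" where
  "spectral_norm A B C T =
     (GREATEST r. \<exists>u\<in>pure_tensors A B C. l2_norm (A \<times> B \<times> C) u = 1 \<and>
        r = cmod (l2_inner (A \<times> B \<times> C) T u))"

definition group_tensor :: "('a, 'm) monoid_scheme \<Rightarrow> 'a \<times> 'a \<times> 'a \<Rightarrow> complex" where
  "group_tensor G = (\<lambda>t. \<Sum>(g, h, k) \<in> {(g, h, k). g \<in> carrier G \<and> h \<in> carrier G \<and> k \<in> carrier G \<and>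
       g \<otimes>\<^bsub>G\<^esub> h \<otimes>\<^bsub>G\<^esub> k = \<one>\<^bsub>G\<^esub>}.
     tensor3 (basis_vec g) (basis_vec h) (basis_vec k) t)"

section \<open>Complex representations\<close>

text \<open>
  A representation of dimension \<open>d\<close> is a homomorphism into \<open>GL\<^sub>d\<close> over the complex numbers, the
  unit group of the matrix ring. Since \<open>hom\<close> constrains maps on the carrier only, so do all notions
  below.
\<close>

definition representation ::
  "('a, 'm) monoid_scheme \<Rightarrow> nat \<Rightarrow> ('a \<Rightarrow> complex mat) \<Rightarrow> bool" where
  "representation G d \<rho> \<longleftrightarrow> \<rho> \<in> hom G (units_of (ring_mat TYPE(complex) d ()))"

definition irreducible_representation ::
  "('a, 'm) monoid_scheme \<Rightarrow> nat \<Rightarrow> ('a \<Rightarrow> complex mat) \<Rightarrow> bool" where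
  "irreducible_representation G d \<rho> \<longleftrightarrow> representation G d \<rho> \<and> d > 0 \<and>
     (\<forall>W. VectorSpace.subspace class_ring W (module_vec TYPE(complex) d) \<and>
          (\<forall>g\<in>carrier G. \<forall>w\<in>W. \<rho> g *\<^sub>v w \<in> W) \<longrightarrow>
        W = {0\<^sub>v d} \<or> W = carrier_vec d)"

text \<open>An invertible matrix is square, so isomorphic representations have equal dimension.\<close>

definition isomorphic_representations ::
  "('a, 'm) monoid_scheme \<Rightarrow> nat \<Rightarrow> ('a \<Rightarrow> complex mat) \<Rightarrow> nat \<Rightarrow> ('a \<Rightarrow> complex mat) \<Rightarrow> bool" where
  "isomorphic_representations G d \<rho> e \<sigma> \<longleftrightarrow>
     (\<exists>P \<in> carrier_mat e d. invertible_mat P \<and> (\<forall>g\<in>carrier G. P * \<rho> g = \<sigma> g * P))"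

end

(*
  Paired with x, y, z the tensor T_G is (conj x * conj y * conj z)(1), a convolution. The bound
  on the spectral norm is Young's inequality, attained at constant functions. By Schur
  orthogonality and completeness, the normalised coefficients
  u_ipq(g) = sqrt(d_i/n) U_i(g)_pq of the unitary irreducible representations U_i form an
  orthonormal basis of CG, in which T_G is a weighted sum of matrix multiplication tensors:
  T_G = sum_i sqrt(n/d_i) sum_pqr u_ipq (x) u_iqr (x) u_irp. This decomposition has total norm
  sqrt(n) sum_i d_i^(5/2). It is optimal by duality: the unweighted sum D of the same terms
  satisfies |<v, D>| <= |v| for pure v, while <T_G, D> = sqrt(n) sum_i d_i^(5/2).
*)

theory Submission
  imports Defs "Jordan_Normal_Form.Spectral_Radius" "HOL-Analysis.L2_Norm"
begin

section \<open>Adjoints, subspaces and orthonormal frames\<close>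

text \<open>The given representations need not be unitary, while normalised coefficients call for
  unitary forms. These are obtained without averaging an inner product and taking its square root:
  completeness is proved first, for unitary irreducibles alone, from the regular representation,
  which is unitary because its matrices are permutation matrices. Splitting a unitary representation
  takes only orthonormal frames, since unitarity keeps the complement of an invariant subspace
  invariant. The constants come from the character of the regular representation: the sum of d_i
  chi_i(g) is n at the identity and 0 elsewhere. The trace of three normalised coefficient matrices
  carries the factor (d_i/n)^(3/2), whereas expanding T_G asks for d_i/n, whence the weight
  sqrt(n/d_i); the d_i^3 terms of that norm produce the exponent 5/2. The bound for D rests on
  |tr(XYZ)| being at most the product of the three Frobenius norms, with Bessel's inequality
  controlling the Fourier coefficients of each tensor factor.\<close>

definition adj :: "complex mat \<Rightarrow> complex mat" where
  "adj A = mat (dim_col A) (dim_row A) (\<lambda>(i, j). cnj (A $$ (j, i)))"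

lemma adj_carrier [simp]: "A \<in> carrier_mat m n \<Longrightarrow> adj A \<in> carrier_mat n m"
  by (auto simp: adj_def)

lemma adj_index [simp]: "i < dim_col A \<Longrightarrow> j < dim_row A \<Longrightarrow> adj A $$ (i, j) = cnj (A $$ (j, i))"
  by (simp add: adj_def)

lemma dim_adj [simp]: "dim_row (adj A) = dim_col A" "dim_col (adj A) = dim_row A"
  by (simp_all add: adj_def)

lemma adj_adj [simp]: "adj (adj A) = A"
  by (rule eq_matI) auto

lemma adj_zero [simp]: "adj (0\<^sub>m m n) = 0\<^sub>m n m"
  by (rule eq_matI) auto

lemma adj_mult:
  assumes "A \<in> carrier_mat l m" "B \<in> carrier_mat m n"
  shows "adj (A * B) = adj B * adj A"
  using assms by (intro eq_matI) (auto simp: scalar_prod_def mult.commute)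

lemma mult_mat_index:
  assumes "A \<in> carrier_mat l m" "B \<in> carrier_mat m n" "i < l" "j < n"
  shows "(A * B) $$ (i, j) = (\<Sum>k<m. A $$ (i, k) * B $$ (k, j))"
  using assms by (auto simp: scalar_prod_def atLeast0LessThan)

lemma mult_mat_vec_index:
  assumes "A \<in> carrier_mat l m" "v \<in> carrier_vec m" "i < l"
  shows "(A *\<^sub>v v) $ i = (\<Sum>k<m. A $$ (i, k) * v $ k)"
  using assms by (auto simp: scalar_prod_def atLeast0LessThan)

lemma mat_eqI_vec:
  fixes A B :: "complex mat"
  assumes A: "A \<in> carrier_mat l m" and B: "B \<in> carrier_mat l m"
    and eq: "\<And>x. x \<in> carrier_vec m \<Longrightarrow> A *\<^sub>v x = B *\<^sub>v x"
  shows "A = B"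
proof (rule eq_matI)
  fix i j assume ij: "i < dim_row B" "j < dim_col B"
  then have "(A *\<^sub>v unit_vec m j) $ i = (B *\<^sub>v unit_vec m j) $ i"
    using eq by simp
  then show "A $$ (i, j) = B $$ (i, j)"
    using A B ij by (auto simp: scalar_prod_right_unit)
qed (use A B in auto)

text \<open>Closure conditions stated directly in \<open>carrier_vec d\<close> keep the module
  records out of the later proofs; \<open>subspace_iff_lin_subspace\<close> is the bridge.\<close>

definition lin_subspace :: "nat \<Rightarrow> complex vec set \<Rightarrow> bool" where
  "lin_subspace d W \<longleftrightarrow> W \<subseteq> carrier_vec d \<and> 0\<^sub>v d \<in> W \<and>
     (\<forall>v\<in>W. \<forall>w\<in>W. v + w \<in> W) \<and> (\<forall>c. \<forall>v\<in>W. c \<cdot>\<^sub>v v \<in> W)"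

lemma subspace_iff_lin_subspace:
  "VectorSpace.subspace class_ring W (module_vec TYPE(complex) d) \<longleftrightarrow> lin_subspace d W"
proof
  assume "VectorSpace.subspace class_ring W (module_vec TYPE(complex) d)"
  then have "submodule class_ring W (module_vec TYPE(complex) d)"
    by (simp add: VectorSpace.subspace_def)
  then show "lin_subspace d W"
    by (auto simp: submodule_def lin_subspace_def module_vec_simps)
next
  assume "lin_subspace d W"
  then have "submodule class_ring W (module_vec TYPE(complex) d)"
    by (auto simp: submodule_def lin_subspace_def module_vec_simps vec_module)
  then show "VectorSpace.subspace class_ring W (module_vec TYPE(complex) d)"
    by (simp add: VectorSpace.subspace_def vec_vs)
qed

text \<open>If k > d, pad \<open>U\<close> with zero rows to a square matrix. Its columns stay
  orthonormal, so its adjoint is a right inverse as well; but row d is zero, which contradicts the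
  diagonal entry 1.\<close>

lemma orthonormal_columns_le:
  assumes U: "U \<in> carrier_mat d k" and on: "adj U * U = 1\<^sub>m k"
  shows "k \<le> d"
proof (rule ccontr)
  assume "\<not> k \<le> d"
  then have dk: "d < k" by simp
  define V where "V = mat k k (\<lambda>(i, j). if i < d then U $$ (i, j) else 0)"
  have V: "V \<in> carrier_mat k k" by (simp add: V_def)
  have "adj V * V = 1\<^sub>m k"
  proof (rule eq_matI)
    fix i j assume ij: "i < dim_row (1\<^sub>m k :: complex mat)" "j < dim_col (1\<^sub>m k :: complex mat)"
    have "(adj V * V) $$ (i, j) = (\<Sum>l<k. adj V $$ (i, l) * V $$ (l, j))"
      using ij V by (intro mult_mat_index) auto
    also have "\<dots> = (\<Sum>l<d. cnj (U $$ (l, i)) * U $$ (l, j))"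
      using dk ij by (intro sum.mono_neutral_cong_right) (auto simp: V_def)
    also have "\<dots> = (adj U * U) $$ (i, j)"
      using ij U by (subst mult_mat_index[of _ k d]) auto
    finally show "(adj V * V) $$ (i, j) = 1\<^sub>m k $$ (i, j)" using on by simp
  qed (use V in auto)
  then have "V * adj V = 1\<^sub>m k"
    using mat_mult_left_right_inverse[OF adj_carrier[OF V] V] by simp
  moreover have "(V * adj V) $$ (d, d) = 0"
    using dk by (subst mult_mat_index[OF V adj_carrier[OF V]]) (auto simp: V_def)
  ultimately show False using dk by simp
qed

text \<open>The enlargement step of the maximality argument for frames. The second claim shows that
  the range grows by multiples of \<open>z\<close> only, so it stays in any subspace that contains
  \<open>z\<close> and the old range.\<close>

lemma orthonormal_frame_snoc:
  assumes U: "U \<in> carrier_mat d k" and on: "adj U * U = 1\<^sub>m k"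
    and z: "z \<in> carrier_vec d" and unit: "(\<Sum>i<d. cnj (z $ i) * z $ i) = 1"
    and orth: "adj U *\<^sub>v z = 0\<^sub>v k"
  defines "V \<equiv> mat d (Suc k) (\<lambda>(i, j). if j < k then U $$ (i, j) else z $ i)"
  shows "adj V * V = 1\<^sub>m (Suc k)"
    and "y \<in> carrier_vec (Suc k) \<Longrightarrow> V *\<^sub>v y = U *\<^sub>v vec k (($) y) + y $ k \<cdot>\<^sub>v z"
proof -
  have V: "V \<in> carrier_mat d (Suc k)" by (simp add: V_def)
  have o: "(\<Sum>l<d. cnj (U $$ (l, i)) * z $ l) = 0" if "i < k" for i
  proof -
    have "(adj U *\<^sub>v z) $ i = (\<Sum>l<d. cnj (U $$ (l, i)) * z $ l)"
      using U z that by (subst mult_mat_vec_index[of _ k d]) auto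
    then show ?thesis using orth that by simp
  qed
  have o': "(\<Sum>l<d. cnj (z $ l) * U $$ (l, i)) = 0" if "i < k" for i
    using arg_cong[OF o[OF that], of cnj] by (simp add: mult.commute)
  have oU: "(\<Sum>l<d. cnj (U $$ (l, i)) * U $$ (l, j)) = (if i = j then 1 else 0)" if "i < k" "j < k" for i j
  proof -
    have "(adj U * U) $$ (i, j) = (\<Sum>l<d. cnj (U $$ (l, i)) * U $$ (l, j))"
      using U that by (subst mult_mat_index[of _ k d]) auto
    then show ?thesis using on that by simp
  qed
  show "adj V * V = 1\<^sub>m (Suc k)"
  proof (rule eq_matI)
    fix i j assume ij: "i < dim_row (1\<^sub>m (Suc k) :: complex mat)" "j < dim_col (1\<^sub>m (Suc k) :: complex mat)"
    have "(adj V * V) $$ (i, j) = (\<Sum>l<d. cnj (V $$ (l, i)) * V $$ (l, j))"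
      using ij V by (subst mult_mat_index[of _ "Suc k" d]) auto
    also have "\<dots> = 1\<^sub>m (Suc k) $$ (i, j)"
      using ij o o' oU unit by (cases "i < k"; cases "j < k") (auto simp: V_def)
    finally show "(adj V * V) $$ (i, j) = 1\<^sub>m (Suc k) $$ (i, j)" .
  qed (use V in auto)
  show "V *\<^sub>v y = U *\<^sub>v vec k (($) y) + y $ k \<cdot>\<^sub>v z" if y: "y \<in> carrier_vec (Suc k)"
  proof (rule eq_vecI)
    fix i assume "i < dim_vec (U *\<^sub>v vec k (($) y) + y $ k \<cdot>\<^sub>v z)"
    then have i: "i < d" using z by simp
    have "(V *\<^sub>v y) $ i = (\<Sum>j<Suc k. V $$ (i, j) * y $ j)"
      using V y i by (subst mult_mat_vec_index[of _ d "Suc k"]) auto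
    also have "\<dots> = (\<Sum>j<k. U $$ (i, j) * y $ j) + z $ i * y $ k"
      using i by (simp add: V_def)
    also have "(\<Sum>j<k. U $$ (i, j) * y $ j) = (U *\<^sub>v vec k (($) y)) $ i"
      using U i by (subst mult_mat_vec_index[of _ d k]) auto
    finally show "(V *\<^sub>v y) $ i = (U *\<^sub>v vec k (($) y) + y $ k \<cdot>\<^sub>v z) $ i"
      using U z i by simp
  qed (use V z in auto)
qed

text \<open>A maximal orthonormal family in \<open>W\<close> spans \<open>W\<close>.\<close>

lemma orthonormal_frame_exists:
  assumes W: "lin_subspace d W"
  obtains k U where "U \<in> carrier_mat d k" "adj U * U = 1\<^sub>m k"
    "\<And>y. y \<in> carrier_vec k \<Longrightarrow> U *\<^sub>v y \<in> W" "\<And>x. x \<in> W \<Longrightarrow> U *\<^sub>v (adj U *\<^sub>v x) = x"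
proof -
  define P where "P k \<longleftrightarrow> (\<exists>U. U \<in> carrier_mat d k \<and> adj U * U = 1\<^sub>m k \<and>
     (\<forall>y\<in>carrier_vec k. U *\<^sub>v y \<in> W))" for k
  have Wc: "W \<subseteq> carrier_vec d" and W0: "0\<^sub>v d \<in> W" and Wadd: "\<And>v w. v \<in> W \<Longrightarrow> w \<in> W \<Longrightarrow> v + w \<in> W"
    and Wsm: "\<And>c v. v \<in> W \<Longrightarrow> c \<cdot>\<^sub>v v \<in> W"
    using W by (auto simp: lin_subspace_def)
  have "P 0"
    unfolding P_def
  proof (intro exI conjI ballI)
    show "0\<^sub>m d 0 \<in> carrier_mat d 0" by simp
    show "adj (0\<^sub>m d 0) * 0\<^sub>m d 0 = 1\<^sub>m 0" by (rule eq_matI) auto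
    fix y :: "complex vec" assume "y \<in> carrier_vec 0"
    then have "0\<^sub>m d 0 *\<^sub>v y = 0\<^sub>v d" by (intro eq_vecI) (auto simp: scalar_prod_def)
    then show "0\<^sub>m d 0 *\<^sub>v y \<in> W" using W0 by simp
  qed
  moreover have "\<forall>k. P k \<longrightarrow> k \<le> d"
    using orthonormal_columns_le by (auto simp: P_def)
  ultimately obtain k where k: "P k" "\<And>j. P j \<Longrightarrow> j \<le> k"
    using GreatestI_nat[of P 0 d] Greatest_le_nat[of P _ d] by blast
  then obtain U where U: "U \<in> carrier_mat d k" and on: "adj U * U = 1\<^sub>m k"
    and UW: "\<And>y. y \<in> carrier_vec k \<Longrightarrow> U *\<^sub>v y \<in> W"
    by (auto simp: P_def)
  have "U *\<^sub>v (adj U *\<^sub>v x) = x" if x: "x \<in> W" for x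
  proof (rule ccontr)
    assume ne: "U *\<^sub>v (adj U *\<^sub>v x) \<noteq> x"
    have xc: "x \<in> carrier_vec d" using x Wc by auto
    \<comment> \<open>If the projection \<open>p\<close> of \<open>x\<close> differs from
      \<open>x\<close>, the residual is a nonzero vector of \<open>W\<close> orthogonal to all
      columns; normalised, it extends the frame and contradicts the maximality of k.\<close>
    define p where "p = U *\<^sub>v (adj U *\<^sub>v x)"
    have Ua: "adj U \<in> carrier_mat k d" using U by (rule adj_carrier)
    have yc: "adj U *\<^sub>v x \<in> carrier_vec k" using Ua xc by simp
    have pc: "p \<in> carrier_vec d" using U yc by (simp add: p_def)
    define z where "z = x - p"
    have zc: "z \<in> carrier_vec d" using xc pc by (simp add: z_def)
    have "z = x + (-1) \<cdot>\<^sub>v p" using xc pc by (intro eq_vecI) (auto simp: z_def)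
    then have zW: "z \<in> W" using x UW[OF yc] Wadd Wsm by (simp add: p_def)
    have "adj U *\<^sub>v p = adj U *\<^sub>v x"
      unfolding p_def
      using U Ua xc yc on by (subst assoc_mult_mat_vec[of _ k d _ k, symmetric]) auto
    then have orth: "adj U *\<^sub>v z = 0\<^sub>v k"
      using Ua xc pc yc by (simp add: z_def mult_minus_distrib_mat_vec[of _ k d])
    have "z \<noteq> 0\<^sub>v d"
    proof
      assume "z = 0\<^sub>v d"
      then have "(x - p) $ i = 0" if "i < d" for i using that by (simp add: z_def)
      then have "x $ i = p $ i" if "i < d" for i using that xc pc by force
      then have "p = x" using xc pc by (intro eq_vecI) auto
      then show False using ne by (simp add: p_def)
    qed
    then obtain i where i: "i < d" "z $ i \<noteq> 0" using zc by (auto simp: vec_eq_iff)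
    define N where "N = (\<Sum>i<d. (cmod (z $ i))\<^sup>2)"
    have "N > 0" unfolding N_def using i by (intro sum_pos2[of _ i]) auto
    define c where "c = complex_of_real (1 / sqrt N)"
    have unit: "(\<Sum>i<d. cnj ((c \<cdot>\<^sub>v z) $ i) * (c \<cdot>\<^sub>v z) $ i) = 1"
    proof -
      have "cnj ((c \<cdot>\<^sub>v z) $ i) * (c \<cdot>\<^sub>v z) $ i = complex_of_real ((cmod (z $ i))\<^sup>2 / N)" if "i < d" for i
      proof -
        have "cnj ((c \<cdot>\<^sub>v z) $ i) * (c \<cdot>\<^sub>v z) $ i = (cnj c * c) * (z $ i * cnj (z $ i))"
          using that zc by (simp add: mult_ac)
        also have "cnj c * c = complex_of_real (1 / N)"
          using \<open>N > 0\<close> unfolding c_def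
          by (simp flip: of_real_mult)
        finally show ?thesis by (simp add: complex_norm_square[symmetric])
      qed
      then have "(\<Sum>i<d. cnj ((c \<cdot>\<^sub>v z) $ i) * (c \<cdot>\<^sub>v z) $ i) = complex_of_real (\<Sum>i<d. (cmod (z $ i))\<^sup>2 / N)"
        by simp
      also have "\<dots> = 1" using \<open>N > 0\<close> by (simp add: N_def sum_divide_distrib[symmetric])
      finally show ?thesis .
    qed
    have cz: "c \<cdot>\<^sub>v z \<in> carrier_vec d" using zc by simp
    have "adj U *\<^sub>v (c \<cdot>\<^sub>v z) = c \<cdot>\<^sub>v (adj U *\<^sub>v z)"
      using Ua zc by (intro mult_mat_vec[of _ k d]) auto
    then have "adj U *\<^sub>v (c \<cdot>\<^sub>v z) = 0\<^sub>v k" using orth by (auto intro: eq_vecI)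
    note snoc = orthonormal_frame_snoc[OF U on cz unit this]
    have "P (Suc k)"
      unfolding P_def
    proof (intro exI conjI ballI)
      show "mat d (Suc k) (\<lambda>(i, j). if j < k then U $$ (i, j) else (c \<cdot>\<^sub>v z) $ i) \<in> carrier_mat d (Suc k)"
        by simp
      show "mat d (Suc k) (\<lambda>(i, j). if j < k then U $$ (i, j) else (c \<cdot>\<^sub>v z) $ i) *\<^sub>v y \<in> W"
        if "y \<in> carrier_vec (Suc k)" for y
        unfolding snoc(2)[OF that] by (intro Wadd Wsm UW zW) simp
    qed (rule snoc(1))
    then show False using k(2) by fastforce
  qed
  then show thesis using that U on UW by blast
qed

section \<open>Coefficients of unitary representations\<close>

lemma triple_mult_index:
  fixes A X B :: "complex mat"
  assumes A: "A \<in> carrier_mat a m" and X: "X \<in> carrier_mat m n" and B: "B \<in> carrier_mat n b"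
    and ij: "i < a" "j < b"
  shows "(A * X * B) $$ (i, j) = (\<Sum>p<m. \<Sum>q<n. A $$ (i, p) * B $$ (q, j) * X $$ (p, q))"
proof -
  have "(A * X * B) $$ (i, j) = (\<Sum>q<n. (A * X) $$ (i, q) * B $$ (q, j))"
    using A X B ij by (intro mult_mat_index) auto
  also have "\<dots> = (\<Sum>q<n. (\<Sum>p<m. A $$ (i, p) * X $$ (p, q)) * B $$ (q, j))"
    using A X ij by (intro sum.cong refl) (simp only: mult_mat_index[OF A X] lessThan_iff)
  also have "\<dots> = (\<Sum>q<n. \<Sum>p<m. A $$ (i, p) * B $$ (q, j) * X $$ (p, q))"
    unfolding sum_distrib_right by (intro sum.cong refl) (simp only: mult_ac)
  finally show ?thesis by (simp only: sum.swap[of _ "{..<n}"])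
qed

lemma sum_triple_mult_index:
  fixes A B :: "complex mat" and X :: "'a \<Rightarrow> complex mat" and f :: "'a \<Rightarrow> complex"
  assumes A: "A \<in> carrier_mat a m" and X: "\<And>g. g \<in> S \<Longrightarrow> X g \<in> carrier_mat m n"
    and B: "B \<in> carrier_mat n b" and ij: "i < a" "j < b"
  shows "(\<Sum>g\<in>S. f g * (A * X g * B) $$ (i, j)) =
    (\<Sum>p<m. \<Sum>q<n. A $$ (i, p) * B $$ (q, j) * (\<Sum>g\<in>S. f g * X g $$ (p, q)))"
proof -
  have "(\<Sum>g\<in>S. f g * (A * X g * B) $$ (i, j)) =
      (\<Sum>g\<in>S. \<Sum>p<m. \<Sum>q<n. A $$ (i, p) * B $$ (q, j) * (f g * X g $$ (p, q)))"
  proof (rule sum.cong[OF refl])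
    fix g assume g: "g \<in> S"
    show "f g * (A * X g * B) $$ (i, j) = (\<Sum>p<m. \<Sum>q<n. A $$ (i, p) * B $$ (q, j) * (f g * X g $$ (p, q)))"
      unfolding triple_mult_index[OF A X[OF g] B ij] sum_distrib_left
      by (intro sum.cong refl) (simp only: mult_ac)
  qed
  also have "\<dots> = (\<Sum>p<m. \<Sum>q<n. \<Sum>g\<in>S. A $$ (i, p) * B $$ (q, j) * (f g * X g $$ (p, q)))"
    by (subst sum.swap, intro sum.cong refl, subst sum.swap, rule refl)
  finally show ?thesis by (simp add: sum_distrib_left)
qed

lemma mult_mat_zero_vec: "A \<in> carrier_mat m n \<Longrightarrow> A *\<^sub>v 0\<^sub>v n = 0\<^sub>v m"
  for A :: "complex mat"
  by (intro eq_vecI) (auto simp: scalar_prod_def)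

lemma zero_mat_mult_vec: "x \<in> carrier_vec n \<Longrightarrow> 0\<^sub>m m n *\<^sub>v x = 0\<^sub>v m"
  for x :: "complex vec"
  by (intro eq_vecI) (auto simp: scalar_prod_def)

lemma mult_mat_assoc4:
  assumes "A \<in> carrier_mat a b" "B \<in> carrier_mat b c" "C \<in> carrier_mat c d" "D \<in> carrier_mat d e"
  shows "A * (B * C) * D = A * B * (C * D)" "A * (B * C * D) = A * B * (C * D)"
  using assms assoc_mult_mat[of "A" a b B c C d] assoc_mult_mat[of "A * B" a c C d D e]
    assoc_mult_mat[of B b c C d D e] assoc_mult_mat[of A a b B c "C * D" e] by simp_all

section \<open>Matrix representations of a finite group and their unitary compressions\<close>

locale finite_group = group G for G (structure) +
  assumes finite_carrier: "finite (carrier G)"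
begin

text \<open>Multiplicativity and the value at \<open>\<one>\<close> make
  \<open>\<rho> (inv g)\<close> a two-sided inverse of \<open>\<rho> g\<close>, so membership in the
  unit group turns into plain matrix equations.\<close>

lemma representation_iff:
  "representation G d \<rho> \<longleftrightarrow> (\<forall>g\<in>carrier G. \<rho> g \<in> carrier_mat d d) \<and> \<rho> \<one> = 1\<^sub>m d \<and>
     (\<forall>g\<in>carrier G. \<forall>h\<in>carrier G. \<rho> (g \<otimes> h) = \<rho> g * \<rho> h)"
    (is "_ \<longleftrightarrow> ?R")
proof
  let ?M = "ring_mat TYPE(complex) d ()"
  interpret M: ring ?M by (rule ring_mat)
  interpret U: group "units_of ?M" by (rule M.units_group)
  { assume "representation G d \<rho>"
    then have h: "\<rho> \<in> hom G (units_of ?M)" by (simp add: representation_def)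
    then interpret group_hom G "units_of ?M" \<rho>
      by unfold_locales
    have "\<rho> g \<in> carrier_mat d d" if "g \<in> carrier G" for g
      using hom_closed[OF that] by (auto simp: units_of_carrier Units_def ring_mat_simps)
    moreover have "\<rho> \<one> = 1\<^sub>m d"
      using hom_one by (simp add: units_of_one ring_mat_simps)
    moreover have "\<rho> (g \<otimes> h) = \<rho> g * \<rho> h" if "g \<in> carrier G" "h \<in> carrier G" for g h
      using hom_mult[OF that] by (simp add: units_of_mult ring_mat_simps)
    ultimately show ?R by blast }
  assume R: ?R
  have "\<rho> g \<in> Units ?M" if "g \<in> carrier G" for g
  proof -
    have "\<rho> (inv g) * \<rho> g = 1\<^sub>m d" "\<rho> g * \<rho> (inv g) = 1\<^sub>m d"
      using R that by (metis inv_closed l_inv, metis inv_closed r_inv)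
    then show ?thesis using R that by (auto simp: Units_def ring_mat_simps)
  qed
  then show "representation G d \<rho>"
    using R by (auto simp: representation_def hom_def units_of_carrier units_of_mult ring_mat_simps)
qed

lemma representationD:
  assumes "representation G d \<rho>"
  shows "g \<in> carrier G \<Longrightarrow> \<rho> g \<in> carrier_mat d d" "\<rho> \<one> = 1\<^sub>m d"
    "g \<in> carrier G \<Longrightarrow> h \<in> carrier G \<Longrightarrow> \<rho> (g \<otimes> h) = \<rho> g * \<rho> h"
  using assms by (auto simp: representation_iff)

text \<open>Unitarity is phrased through \<open>inv g\<close> because the orthogonality relations
  contain values at inverses: the conjugate of entry (p, q) at g is entry (q, p) at
  \<open>inv g\<close>.\<close>

definition unitary_rep :: "nat \<Rightarrow> ('a \<Rightarrow> complex mat) \<Rightarrow> bool" where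
  "unitary_rep d \<sigma> \<longleftrightarrow> representation G d \<sigma> \<and> (\<forall>g\<in>carrier G. \<sigma> (inv g) = adj (\<sigma> g))"

definition invariant :: "nat \<Rightarrow> ('a \<Rightarrow> complex mat) \<Rightarrow> complex vec set \<Rightarrow> bool" where
  "invariant d \<sigma> W \<longleftrightarrow> lin_subspace d W \<and> (\<forall>g\<in>carrier G. \<forall>w\<in>W. \<sigma> g *\<^sub>v w \<in> W)"

lemma irreducible_iff:
  "irreducible_representation G d \<rho> \<longleftrightarrow> representation G d \<rho> \<and> d > 0 \<and>
     (\<forall>W. invariant d \<rho> W \<longrightarrow> W = {0\<^sub>v d} \<or> W = carrier_vec d)"
  by (simp add: irreducible_representation_def invariant_def subspace_iff_lin_subspace)

text \<open>The projection \<open>U * adj U\<close> onto \<open>W\<close> fixes the columns of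
  \<open>\<sigma> g * U\<close>, so it may be inserted between the factors of a product; this makes
  the compression multiplicative. That \<open>W\<close> is proper gives k < d, which drives the
  induction on the dimension.\<close>

lemma unitary_rep_compress:
  assumes \<sigma>: "unitary_rep d \<sigma>" and W: "invariant d \<sigma> W" and proper: "W \<noteq> carrier_vec d"
  obtains k U where "k < d" "U \<in> carrier_mat d k" "adj U * U = 1\<^sub>m k"
    "\<And>y. y \<in> carrier_vec k \<Longrightarrow> U *\<^sub>v y \<in> W" "\<And>x. x \<in> W \<Longrightarrow> U *\<^sub>v (adj U *\<^sub>v x) = x"
    "\<And>g. g \<in> carrier G \<Longrightarrow> U * adj U * (\<sigma> g * U) = \<sigma> g * U"
    "unitary_rep k (\<lambda>g. adj U * \<sigma> g * U)"
proof -
  have lin: "lin_subspace d W" and inv: "\<And>g w. g \<in> carrier G \<Longrightarrow> w \<in> W \<Longrightarrow> \<sigma> g *\<^sub>v w \<in> W"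
    using W by (auto simp: invariant_def)
  have Wc: "W \<subseteq> carrier_vec d" using lin by (simp add: lin_subspace_def)
  obtain k U where U: "U \<in> carrier_mat d k" and on: "adj U * U = 1\<^sub>m k"
    and UW: "\<And>y. y \<in> carrier_vec k \<Longrightarrow> U *\<^sub>v y \<in> W"
    and proj: "\<And>x. x \<in> W \<Longrightarrow> U *\<^sub>v (adj U *\<^sub>v x) = x"
    using orthonormal_frame_exists[OF lin] by metis
  have rep: "representation G d \<sigma>" and un: "\<And>g. g \<in> carrier G \<Longrightarrow> \<sigma> (inv g) = adj (\<sigma> g)"
    using \<sigma> by (auto simp: unitary_rep_def)
  note \<sigma>c = representationD(1)[OF rep]
  have Ua: "adj U \<in> carrier_mat k d" using U by (rule adj_carrier)
  have "k \<noteq> d"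
  proof
    assume kd: "k = d"
    then have UU: "U * adj U = 1\<^sub>m d"
      using U on by (intro mat_mult_left_right_inverse[of "adj U"]) auto
    have "x \<in> W" if "x \<in> carrier_vec d" for x
    proof -
      have "U *\<^sub>v (adj U *\<^sub>v x) = x"
        using U Ua that UU by (subst assoc_mult_mat_vec[symmetric]) auto
      then show ?thesis using UW[of "adj U *\<^sub>v x"] Ua that kd by auto
    qed
    then show False using Wc proper by blast
  qed
  then have kd: "k < d" using orthonormal_columns_le[OF U on] by simp
  have key: "U * adj U * (\<sigma> g * U) = \<sigma> g * U" if g: "g \<in> carrier G" for g
  proof (rule mat_eqI_vec)
    fix x :: "complex vec" assume x: "x \<in> carrier_vec k"
    have w: "\<sigma> g *\<^sub>v (U *\<^sub>v x) \<in> W" using inv[OF g UW[OF x]] .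
    have "U * adj U * (\<sigma> g * U) *\<^sub>v x = (U * adj U) *\<^sub>v ((\<sigma> g * U) *\<^sub>v x)"
      using U Ua \<sigma>c[OF g] x by (intro assoc_mult_mat_vec) auto
    also have "(\<sigma> g * U) *\<^sub>v x = \<sigma> g *\<^sub>v (U *\<^sub>v x)"
      using U \<sigma>c[OF g] x by (intro assoc_mult_mat_vec) auto
    also have "(U * adj U) *\<^sub>v (\<sigma> g *\<^sub>v (U *\<^sub>v x)) = U *\<^sub>v (adj U *\<^sub>v (\<sigma> g *\<^sub>v (U *\<^sub>v x)))"
      using U Ua w Wc by (intro assoc_mult_mat_vec) auto
    also have "\<dots> = \<sigma> g *\<^sub>v (U *\<^sub>v x)" by (rule proj[OF w])
    also have "\<dots> = (\<sigma> g * U) *\<^sub>v x"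
      using U \<sigma>c[OF g] x by (intro assoc_mult_mat_vec[symmetric]) auto
    finally show "U * adj U * (\<sigma> g * U) *\<^sub>v x = (\<sigma> g * U) *\<^sub>v x" .
  qed (use U Ua \<sigma>c[OF g] in auto)
  have "representation G k (\<lambda>g. adj U * \<sigma> g * U)"
    unfolding representation_iff
  proof (intro conjI ballI)
    fix g assume g: "g \<in> carrier G"
    show "adj U * \<sigma> g * U \<in> carrier_mat k k" using U Ua \<sigma>c[OF g] by auto
    fix h assume h: "h \<in> carrier G"
    note c = U Ua \<sigma>c[OF g] \<sigma>c[OF h]
    have "adj U * \<sigma> (g \<otimes> h) * U = adj U * \<sigma> g * (\<sigma> h * U)"
      unfolding representationD(3)[OF rep g h] by (rule mult_mat_assoc4(1)[OF Ua \<sigma>c[OF g] \<sigma>c[OF h] U])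
    also have "\<dots> = adj U * \<sigma> g * (U * adj U * (\<sigma> h * U))" by (simp only: key[OF h])
    also have "\<dots> = adj U * \<sigma> g * U * (adj U * (\<sigma> h * U))"
      by (rule mult_mat_assoc4(2)) (use c in auto)
    also have "adj U * (\<sigma> h * U) = adj U * \<sigma> h * U"
      using c by (intro assoc_mult_mat[symmetric]) auto
    finally show "adj U * \<sigma> (g \<otimes> h) * U = adj U * \<sigma> g * U * (adj U * \<sigma> h * U)" .
  next
    show "adj U * \<sigma> \<one> * U = 1\<^sub>m k" using representationD(2)[OF rep] U Ua on by simp
  qed
  moreover have "adj U * \<sigma> (inv g) * U = adj (adj U * \<sigma> g * U)" if g: "g \<in> carrier G" for g
  proof -
    have "adj (adj U * \<sigma> g * U) = adj U * adj (adj U * \<sigma> g)"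
      using U Ua \<sigma>c[OF g] by (intro adj_mult) auto
    also have "adj (adj U * \<sigma> g) = adj (\<sigma> g) * adj (adj U)"
      using U Ua \<sigma>c[OF g] by (intro adj_mult) auto
    finally show ?thesis
      using U Ua \<sigma>c[OF g] by (simp add: un[OF g] assoc_mult_mat[of _ k d _ d _ k])
  qed
  ultimately have "unitary_rep k (\<lambda>g. adj U * \<sigma> g * U)" by (simp add: unitary_rep_def)
  then show thesis using that kd U on UW proj key by blast
qed

section \<open>Completeness of the coefficients of unitary irreducible representations\<close>

definition orth_coeffs :: "('a \<Rightarrow> complex) \<Rightarrow> nat \<Rightarrow> ('a \<Rightarrow> complex mat) \<Rightarrow> bool" where
  "orth_coeffs f d \<sigma> \<longleftrightarrow> (\<forall>p<d. \<forall>q<d. (\<Sum>g\<in>carrier G. f g * \<sigma> g $$ (p, q)) = 0)"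

definition unitary_irrep :: "nat \<Rightarrow> ('a \<Rightarrow> complex mat) \<Rightarrow> bool" where
  "unitary_irrep d \<sigma> \<longleftrightarrow> irreducible_representation G d \<sigma> \<and> unitary_rep d \<sigma>"

text \<open>The pairing in \<open>orth_coeffs\<close> is bilinear, without conjugation, and the
  entries of \<open>A * \<sigma> g * B\<close> are combinations of entries of
  \<open>\<sigma> g\<close> with coefficients independent of g. This is how orthogonality passes
  between a representation, its compressions and its isomorphic copies.\<close>

lemma orth_coeffs_triple_mult:
  assumes "orth_coeffs f d \<sigma>" "\<And>g. g \<in> carrier G \<Longrightarrow> \<sigma> g \<in> carrier_mat d d"
    "A \<in> carrier_mat a d" "B \<in> carrier_mat d b" "i < a" "j < b"
  shows "(\<Sum>g\<in>carrier G. f g * (A * \<sigma> g * B) $$ (i, j)) = 0"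
  using assms by (subst sum_triple_mult_index[of A a d _ _ d B b]) (auto simp: orth_coeffs_def)

text \<open>The coefficients of a reducible unitary representation are sums of coefficients of its
  compressions to an invariant subspace and to the orthogonal complement.\<close>

lemma orth_coeffs_unitary_rep:
  assumes orth: "\<And>e \<tau>. unitary_irrep e \<tau> \<Longrightarrow> orth_coeffs f e \<tau>"
  shows "unitary_rep d \<sigma> \<Longrightarrow> orth_coeffs f d \<sigma>"
proof (induction d arbitrary: \<sigma> rule: less_induct)
  case (less d)
  have rep: "representation G d \<sigma>" and un: "\<And>g. g \<in> carrier G \<Longrightarrow> \<sigma> (inv g) = adj (\<sigma> g)"
    using less.prems by (auto simp: unitary_rep_def)
  note \<sigma>c = representationD(1)[OF rep]
  show ?case
  \<comment> \<open>Irreducibility includes d > 0, so for d = 0 its failure yields no subspace to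
    split along; there the claim is vacuous.\<close>
  proof (cases "irreducible_representation G d \<sigma> \<or> d = 0")
    case True
    then show ?thesis using orth less.prems by (auto simp: unitary_irrep_def orth_coeffs_def)
  next
    case False
    then obtain W where W: "invariant d \<sigma> W" "W \<noteq> {0\<^sub>v d}" "W \<noteq> carrier_vec d"
      using rep by (auto simp: irreducible_iff)
    have Wc: "W \<subseteq> carrier_vec d" "0\<^sub>v d \<in> W" using W by (auto simp: invariant_def lin_subspace_def)
    obtain k U where kd: "k < d" and U: "U \<in> carrier_mat d k" and on: "adj U * U = 1\<^sub>m k"
      and UW: "\<And>y. y \<in> carrier_vec k \<Longrightarrow> U *\<^sub>v y \<in> W"
      and proj: "\<And>x. x \<in> W \<Longrightarrow> U *\<^sub>v (adj U *\<^sub>v x) = x"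
      and key: "\<And>g. g \<in> carrier G \<Longrightarrow> U * adj U * (\<sigma> g * U) = \<sigma> g * U"
      and U\<sigma>: "unitary_rep k (\<lambda>g. adj U * \<sigma> g * U)"
      by (rule unitary_rep_compress[OF less.prems W(1,3)]) (rule that, assumption+)
    have Ua: "adj U \<in> carrier_mat k d" using U by (rule adj_carrier)
    define W' where "W' = {x \<in> carrier_vec d. adj U *\<^sub>v x = 0\<^sub>v k}"
    \<comment> \<open>The adjoint of \<open>key\<close> at \<open>inv g\<close>: unitarity turns the
      invariance of \<open>W\<close> into the identity that makes its orthogonal complement
      \<open>W'\<close> invariant.\<close>
    have key': "adj U * \<sigma> g = adj U * \<sigma> g * U * adj U" if g: "g \<in> carrier G" for g
    proof -
      note c = U Ua \<sigma>c[OF g]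
      have gi: "inv g \<in> carrier G" using g by simp
      have "adj (\<sigma> (inv g)) = \<sigma> g" using un[OF gi] g by simp
      then have "adj U * \<sigma> g = adj (\<sigma> (inv g) * U)"
        using adj_mult[OF \<sigma>c[OF gi] U] by simp
      also have "\<dots> = adj (U * adj U * (\<sigma> (inv g) * U))" by (simp only: key[OF gi])
      also have "\<dots> = adj (\<sigma> (inv g) * U) * adj (U * adj U)"
        using c \<sigma>c[OF gi] by (intro adj_mult[of _ d d _ k]) auto
      also have "adj (\<sigma> (inv g) * U) = adj U * \<sigma> g"
        using adj_mult[OF \<sigma>c[OF gi] U] \<open>adj (\<sigma> (inv g)) = \<sigma> g\<close> by simp
      also have "adj (U * adj U) = U * adj U" using adj_mult[OF U Ua] by simp
      also have "adj U * \<sigma> g * (U * adj U) = adj U * \<sigma> g * U * adj U"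
        using c by (intro assoc_mult_mat[symmetric]) auto
      finally show ?thesis .
    qed
    have "invariant d \<sigma> W'"
      unfolding invariant_def
    proof (intro conjI ballI)
      show "lin_subspace d W'"
        unfolding lin_subspace_def W'_def
        using Ua by (auto simp: mult_mat_zero_vec mult_add_distrib_mat_vec[of _ k d] mult_mat_vec[of _ k d])
      fix g w assume g: "g \<in> carrier G" and w: "w \<in> W'"
      note c = U Ua \<sigma>c[OF g]
      have wc: "w \<in> carrier_vec d" "adj U *\<^sub>v w = 0\<^sub>v k" using w by (auto simp: W'_def)
      have "adj U *\<^sub>v (\<sigma> g *\<^sub>v w) = adj U * \<sigma> g *\<^sub>v w"
        using c wc by (intro assoc_mult_mat_vec[symmetric]) auto
      also have "\<dots> = adj U * \<sigma> g * U * adj U *\<^sub>v w" by (simp only: key'[OF g, symmetric])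
      also have "\<dots> = (adj U * \<sigma> g * U) *\<^sub>v (adj U *\<^sub>v w)"
        using c wc by (intro assoc_mult_mat_vec[of _ k k _ d]) auto
      also have "\<dots> = 0\<^sub>v k" unfolding wc(2) using c by (intro mult_mat_zero_vec) auto
      finally show "\<sigma> g *\<^sub>v w \<in> W'" using c wc by (auto simp: W'_def)
    qed
    moreover have "W' \<noteq> carrier_vec d"
    proof
      assume all: "W' = carrier_vec d"
      have "x = 0\<^sub>v d" if "x \<in> W" for x
      proof -
        have "x \<in> W'" using all Wc that by auto
        then show ?thesis using proj[OF that] U by (auto simp: W'_def)
      qed
      then have "W = {0\<^sub>v d}" using Wc(2) by blast
      then show False using W(2) by contradiction
    qed
    ultimately obtain l V where ld: "l < d" and V: "V \<in> carrier_mat d l" and onV: "adj V * V = 1\<^sub>m l"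
      and VW: "\<And>y. y \<in> carrier_vec l \<Longrightarrow> V *\<^sub>v y \<in> W'"
      and projV: "\<And>x. x \<in> W' \<Longrightarrow> V *\<^sub>v (adj V *\<^sub>v x) = x"
      and keyV: "\<And>g. g \<in> carrier G \<Longrightarrow> V * adj V * (\<sigma> g * V) = \<sigma> g * V"
      and V\<sigma>: "unitary_rep l (\<lambda>g. adj V * \<sigma> g * V)"
      by (rule unitary_rep_compress[OF less.prems]) (rule that, assumption+)
    have Va: "adj V \<in> carrier_mat l d" using V by (rule adj_carrier)
    have UV: "adj U * V = 0\<^sub>m k l"
    proof (rule mat_eqI_vec)
      fix x :: "complex vec" assume x: "x \<in> carrier_vec l"
      have "(adj U * V) *\<^sub>v x = adj U *\<^sub>v (V *\<^sub>v x)"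
        using Ua V x by (intro assoc_mult_mat_vec) auto
      also have "\<dots> = 0\<^sub>v k" using VW[OF x] by (simp add: W'_def)
      finally show "(adj U * V) *\<^sub>v x = 0\<^sub>m k l *\<^sub>v x"
        using x by (simp add: zero_mat_mult_vec)
    qed (use Ua V in auto)
    have VU: "adj V * U = 0\<^sub>m l k"
      using arg_cong[OF UV, of adj] adj_mult[OF Ua V] by simp
    \<comment> \<open>The two projections add up to the identity: with \<open>u\<close> the part of
      \<open>x\<close> in \<open>W\<close>, the rest \<open>x - u\<close> lies in \<open>W'\<close>,
      where \<open>V * adj V\<close> acts as the identity, while \<open>adj V\<close> kills
      \<open>u\<close>.\<close>
    have one: "U * adj U + V * adj V = 1\<^sub>m d"
    proof (rule mat_eqI_vec)
      fix x :: "complex vec" assume x: "x \<in> carrier_vec d"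
      define u where "u = U *\<^sub>v (adj U *\<^sub>v x)"
      have Uxc: "adj U *\<^sub>v x \<in> carrier_vec k" by (rule mult_mat_vec_carrier[OF Ua x])
      have uc: "u \<in> carrier_vec d" unfolding u_def by (rule mult_mat_vec_carrier[OF U Uxc])
      have "adj U *\<^sub>v u = adj U *\<^sub>v x"
        unfolding u_def assoc_mult_mat_vec[OF Ua U Uxc, symmetric] on by (rule one_mult_mat_vec[OF Uxc])
      then have "adj U *\<^sub>v (x - u) = 0\<^sub>v k"
        using Ua x uc Uxc by (simp add: mult_minus_distrib_mat_vec[of _ k d])
      then have "x - u \<in> W'" using x uc by (auto simp: W'_def)
      then have p: "V *\<^sub>v (adj V *\<^sub>v (x - u)) = x - u" by (rule projV)
      have "adj V *\<^sub>v u = (adj V * U) *\<^sub>v (adj U *\<^sub>v x)"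
        unfolding u_def by (rule assoc_mult_mat_vec[OF Va U Uxc, symmetric])
      then have "adj V *\<^sub>v u = 0\<^sub>v l" using VU Uxc by (simp add: zero_mat_mult_vec)
      then have "adj V *\<^sub>v (x - u) = adj V *\<^sub>v x"
        using Va x uc by (subst mult_minus_distrib_mat_vec[of _ l d]) auto
      then have q: "V *\<^sub>v (adj V *\<^sub>v x) = x - u" using p by simp
      have "(U * adj U + V * adj V) *\<^sub>v x = (U * adj U) *\<^sub>v x + (V * adj V) *\<^sub>v x"
        by (rule add_mult_distrib_mat_vec[OF mult_carrier_mat[OF U Ua] mult_carrier_mat[OF V Va] x])
      also have "(U * adj U) *\<^sub>v x = u" unfolding u_def by (rule assoc_mult_mat_vec[OF U Ua x])
      also have "(V * adj V) *\<^sub>v x = x - u"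
        unfolding q[symmetric] by (rule assoc_mult_mat_vec[OF V Va x])
      also have "u + (x - u) = x" using x uc by (intro eq_vecI) auto
      finally show "(U * adj U + V * adj V) *\<^sub>v x = 1\<^sub>m d *\<^sub>v x" using x by simp
    qed (use U Ua V Va in auto)
    have split: "\<sigma> g = U * (adj U * \<sigma> g * U) * adj U + V * (adj V * \<sigma> g * V) * adj V"
      if g: "g \<in> carrier G" for g
    proof -
      note c = U Ua V Va \<sigma>c[OF g]
      have "\<sigma> g = \<sigma> g * (U * adj U + V * adj V)" using one c by simp
      also have "\<dots> = \<sigma> g * (U * adj U) + \<sigma> g * (V * adj V)"
        by (rule mult_add_distrib_mat[OF \<sigma>c[OF g] mult_carrier_mat[OF U Ua] mult_carrier_mat[OF V Va]])
      also have "\<sigma> g * (U * adj U) = \<sigma> g * U * adj U"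
        by (rule assoc_mult_mat[OF \<sigma>c[OF g] U Ua, symmetric])
      also have "\<sigma> g * (V * adj V) = \<sigma> g * V * adj V"
        by (rule assoc_mult_mat[OF \<sigma>c[OF g] V Va, symmetric])
      also have "\<sigma> g * U = U * (adj U * \<sigma> g * U)"
        unfolding mult_mat_assoc4(2)[OF U Ua \<sigma>c[OF g] U] by (rule key[OF g, symmetric])
      also have "\<sigma> g * V = V * (adj V * \<sigma> g * V)"
        unfolding mult_mat_assoc4(2)[OF V Va \<sigma>c[OF g] V] by (rule keyV[OF g, symmetric])
      finally show ?thesis .
    qed
    have oU: "orth_coeffs f k (\<lambda>g. adj U * \<sigma> g * U)" by (rule less.IH[OF kd U\<sigma>])
    have oV: "orth_coeffs f l (\<lambda>g. adj V * \<sigma> g * V)" by (rule less.IH[OF ld V\<sigma>])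
    show ?thesis
      unfolding orth_coeffs_def
    proof (intro allI impI)
      fix p q assume pq: "p < d" "q < d"
      have "\<sigma> g $$ (p, q) = (U * (adj U * \<sigma> g * U) * adj U) $$ (p, q)
          + (V * (adj V * \<sigma> g * V) * adj V) $$ (p, q)" if g: "g \<in> carrier G" for g
        using pq U V by (subst split[OF g], subst index_add_mat(1)) auto
      then have "(\<Sum>g\<in>carrier G. f g * \<sigma> g $$ (p, q)) =
          (\<Sum>g\<in>carrier G. f g * (U * (adj U * \<sigma> g * U) * adj U) $$ (p, q)) +
          (\<Sum>g\<in>carrier G. f g * (V * (adj V * \<sigma> g * V) * adj V) $$ (p, q))"
        by (simp add: distrib_left sum.distrib)
      also have "(\<Sum>g\<in>carrier G. f g * (U * (adj U * \<sigma> g * U) * adj U) $$ (p, q)) = 0"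
        by (rule orth_coeffs_triple_mult[OF oU mult_carrier_mat[OF mult_carrier_mat[OF Ua \<sigma>c] U] U Ua pq])
      also have "(\<Sum>g\<in>carrier G. f g * (V * (adj V * \<sigma> g * V) * adj V) $$ (p, q)) = 0"
        by (rule orth_coeffs_triple_mult[OF oV mult_carrier_mat[OF mult_carrier_mat[OF Va \<sigma>c] V] V Va pq])
      finally show "(\<Sum>g\<in>carrier G. f g * \<sigma> g $$ (p, q)) = 0" by simp
    qed
  qed
qed

text \<open>In the left regular representation, the coefficient in the row of \<open>x\<close> and
  the column of \<open>\<one>\<close> is the indicator of g = x, so pairing it with \<open>f\<close>
  returns \<open>f x\<close>. The enumeration \<open>e\<close> of the group serves to number rows
  and columns.\<close>

lemma orth_coeffs_imp_zero:
  assumes orth: "\<And>e \<tau>. unitary_irrep e \<tau> \<Longrightarrow> orth_coeffs f e \<tau>" and x: "x \<in> carrier G"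
  shows "f x = 0"
proof -
  let ?n = "card (carrier G)"
  obtain e where e: "bij_betw e {..<?n} (carrier G)"
    using ex_bij_betw_nat_finite[OF finite_carrier] atLeast0LessThan by metis
  have ec: "e p \<in> carrier G" if "p < ?n" for p using e that by (auto simp: bij_betw_def)
  define R where "R g = mat ?n ?n (\<lambda>(p, q). if e p = g \<otimes> e q then 1 else (0::complex))" for g
  have "representation G ?n R"
    unfolding representation_iff
  proof (intro conjI ballI)
    fix g h assume g: "g \<in> carrier G" and h: "h \<in> carrier G"
    show "R (g \<otimes> h) = R g * R h"
    proof (rule eq_matI)
      fix p q assume pq: "p < dim_row (R g * R h)" "q < dim_col (R g * R h)"
      then have pq: "p < ?n" "q < ?n" by (auto simp: R_def)
      have "(R g * R h) $$ (p, q) = (\<Sum>r<?n. R g $$ (p, r) * R h $$ (r, q))"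
        using pq by (intro mult_mat_index) (auto simp: R_def)
      also have "\<dots> = (\<Sum>r<?n. (\<lambda>y. if e p = g \<otimes> y \<and> y = h \<otimes> e q then 1 else 0) (e r))"
        using pq by (intro sum.cong) (auto simp: R_def)
      also have "\<dots> = (\<Sum>y\<in>carrier G. if e p = g \<otimes> y \<and> y = h \<otimes> e q then 1 else 0)"
        by (rule sum.reindex_bij_betw[OF e])
      also have "\<dots> = (\<Sum>y\<in>carrier G. if y = h \<otimes> e q then (if e p = g \<otimes> (h \<otimes> e q) then 1 else 0) else 0)"
        by (intro sum.cong) auto
      also have "\<dots> = R (g \<otimes> h) $$ (p, q)"
        using pq g h ec finite_carrier by (simp add: R_def m_assoc)
      finally show "R (g \<otimes> h) $$ (p, q) = (R g * R h) $$ (p, q)" ..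
    qed (auto simp: R_def)
  next
    show "R \<one> = 1\<^sub>m ?n"
      using e ec by (intro eq_matI) (auto simp: R_def bij_betw_def inj_on_def)
  qed (auto simp: R_def)
  moreover have "R (inv g) = adj (R g)" if "g \<in> carrier G" for g
    using that ec by (intro eq_matI) (auto simp: R_def inv_solve_left)
  ultimately have "unitary_rep ?n R" by (simp add: unitary_rep_def)
  from orth_coeffs_unitary_rep[OF orth this] have 0: "orth_coeffs f ?n R" .
  have "e ` {..<?n} = carrier G" using e by (rule bij_betw_imp_surj_on)
  then have "x \<in> e ` {..<?n}" "\<one> \<in> e ` {..<?n}" using x one_closed by blast+
  then obtain p q where pq: "p < ?n" "q < ?n" "e p = x" "e q = \<one>" by (elim imageE) auto
  have "(\<Sum>g\<in>carrier G. f g * R g $$ (p, q)) = (\<Sum>g\<in>carrier G. if x = g then f g else 0)"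
  proof (rule sum.cong[OF refl])
    fix g assume "g \<in> carrier G"
    then show "f g * R g $$ (p, q) = (if x = g then f g else 0)"
      unfolding R_def using pq by simp
  qed
  also have "\<dots> = f x" using x finite_carrier by simp
  finally show ?thesis using 0 pq by (simp add: orth_coeffs_def)
qed

section \<open>Schur's lemma and orthogonality\<close>

definition intertwiner :: "nat \<Rightarrow> ('a \<Rightarrow> complex mat) \<Rightarrow> nat \<Rightarrow> ('a \<Rightarrow> complex mat) \<Rightarrow> complex mat \<Rightarrow> bool"
  where "intertwiner d \<rho> e \<sigma> P \<longleftrightarrow> P \<in> carrier_mat e d \<and> (\<forall>g\<in>carrier G. P * \<rho> g = \<sigma> g * P)"

lemma isomorphic_iff:
  "isomorphic_representations G d \<rho> e \<sigma> \<longleftrightarrow>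
     (\<exists>P Q. intertwiner d \<rho> e \<sigma> P \<and> d = e \<and> Q \<in> carrier_mat d d \<and> P * Q = 1\<^sub>m d \<and> Q * P = 1\<^sub>m d)"
proof
  assume "isomorphic_representations G d \<rho> e \<sigma>"
  then obtain P Q where P: "P \<in> carrier_mat e d" "\<forall>g\<in>carrier G. P * \<rho> g = \<sigma> g * P"
    and Q: "square_mat P" "P * Q = 1\<^sub>m (dim_row P)" "Q * P = 1\<^sub>m (dim_row Q)"
    unfolding isomorphic_representations_def invertible_mat_def inverts_mat_def by blast
  have "d = e" using P Q by auto
  moreover have "dim_row Q = d" using arg_cong[OF Q(3), of dim_col] P by auto
  moreover have "dim_col Q = d" using arg_cong[OF Q(2), of dim_col] P \<open>d = e\<close> by auto
  ultimately show "\<exists>P Q. intertwiner d \<rho> e \<sigma> P \<and> d = e \<and> Q \<in> carrier_mat d d \<and> P * Q = 1\<^sub>m d \<and> Q * P = 1\<^sub>m d"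
    using P Q by (intro exI[of _ P] exI[of _ Q]) (auto simp: intertwiner_def)
next
  assume "\<exists>P Q. intertwiner d \<rho> e \<sigma> P \<and> d = e \<and> Q \<in> carrier_mat d d \<and> P * Q = 1\<^sub>m d \<and> Q * P = 1\<^sub>m d"
  then obtain P Q where P: "intertwiner d \<rho> e \<sigma> P" and de: "d = e" and Q: "Q \<in> carrier_mat d d"
    and PQ: "P * Q = 1\<^sub>m d" "Q * P = 1\<^sub>m d" by blast
  have Pc: "P \<in> carrier_mat e d" using P by (simp add: intertwiner_def)
  have "invertible_mat P"
    unfolding invertible_mat_def inverts_mat_def using Pc Q PQ de by auto
  then show "isomorphic_representations G d \<rho> e \<sigma>"
    using P unfolding isomorphic_representations_def intertwiner_def by blast
qed

lemma isomorphic_dim: "isomorphic_representations G d \<rho> e \<sigma> \<Longrightarrow> d = e"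
  by (auto simp: isomorphic_iff)

text \<open>Together with transitivity this carries distinctness from the given representations over
  to their unitary forms.\<close>

lemma isomorphic_sym:
  assumes iso: "isomorphic_representations G d \<rho> e \<sigma>"
    and rep: "representation G d \<rho>" "representation G e \<sigma>"
  shows "isomorphic_representations G e \<sigma> d \<rho>"
proof -
  obtain P Q where P: "intertwiner d \<rho> d \<sigma> P" and de: "d = e" and Q: "Q \<in> carrier_mat d d"
    and PQ: "P * Q = 1\<^sub>m d" "Q * P = 1\<^sub>m d"
    using iso by (auto simp: isomorphic_iff)
  have Pc: "P \<in> carrier_mat d d" using P by (simp add: intertwiner_def)
  have "Q * \<sigma> g = \<rho> g * Q" if g: "g \<in> carrier G" for g
  proof -
    have c: "\<rho> g \<in> carrier_mat d d" "\<sigma> g \<in> carrier_mat d d"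
      using representationD(1)[OF rep(1) g] representationD(1)[OF rep(2) g] de by simp_all
    have "Q * \<sigma> g = Q * \<sigma> g * (P * Q)" using c Q PQ by simp
    also have "\<dots> = Q * (\<sigma> g * P) * Q"
      by (rule mult_mat_assoc4(1)[OF Q c(2) Pc Q, symmetric])
    also have "\<sigma> g * P = P * \<rho> g" using P g by (simp add: intertwiner_def)
    also have "Q * (P * \<rho> g) * Q = (Q * P) * (\<rho> g * Q)"
      by (rule mult_mat_assoc4(1)[OF Q Pc c(1) Q])
    also have "\<dots> = \<rho> g * Q" using PQ c Q by simp
    finally show ?thesis .
  qed
  then have "intertwiner d \<sigma> d \<rho> Q" using Q by (simp add: intertwiner_def)
  then show ?thesis using de Pc PQ unfolding isomorphic_iff by blast
qed

lemma isomorphic_trans: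
  assumes iso: "isomorphic_representations G d \<rho> e \<sigma>" "isomorphic_representations G e \<sigma> f \<tau>"
    and rep: "representation G d \<rho>" "representation G e \<sigma>" "representation G f \<tau>"
  shows "isomorphic_representations G d \<rho> f \<tau>"
proof -
  obtain P Q where P: "intertwiner d \<rho> d \<sigma> P" and de: "d = e" and Q: "Q \<in> carrier_mat d d"
    and PQ: "P * Q = 1\<^sub>m d" "Q * P = 1\<^sub>m d"
    using iso(1) by (auto simp: isomorphic_iff)
  obtain R S where R: "intertwiner d \<sigma> d \<tau> R" and df: "d = f" and S: "S \<in> carrier_mat d d"
    and RS: "R * S = 1\<^sub>m d" "S * R = 1\<^sub>m d"
    using iso(2) de by (auto simp: isomorphic_iff)
  have Pc: "P \<in> carrier_mat d d" and Rc: "R \<in> carrier_mat d d"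
    using P R by (simp_all add: intertwiner_def)
  have "R * P * \<rho> g = \<tau> g * (R * P)" if g: "g \<in> carrier G" for g
  proof -
    have c: "\<rho> g \<in> carrier_mat d d" "\<sigma> g \<in> carrier_mat d d" "\<tau> g \<in> carrier_mat d d"
      using representationD(1)[OF rep(1) g] representationD(1)[OF rep(2) g]
        representationD(1)[OF rep(3) g] de df by simp_all
    have "R * P * \<rho> g = R * (P * \<rho> g)" by (rule assoc_mult_mat[OF Rc Pc c(1)])
    also have "P * \<rho> g = \<sigma> g * P" using P g by (simp add: intertwiner_def)
    also have "R * (\<sigma> g * P) = R * \<sigma> g * P" by (rule assoc_mult_mat[OF Rc c(2) Pc, symmetric])
    also have "R * \<sigma> g = \<tau> g * R" using R g by (simp add: intertwiner_def)
    also have "\<tau> g * R * P = \<tau> g * (R * P)" by (rule assoc_mult_mat[OF c(3) Rc Pc])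
    finally show ?thesis .
  qed
  then have "intertwiner d \<rho> d \<tau> (R * P)" using Pc Rc by (simp add: intertwiner_def)
  moreover have "R * P * (Q * S) = 1\<^sub>m d"
    using mult_mat_assoc4(1)[OF Rc Pc Q S] PQ RS Rc by simp
  moreover have "Q * S * (R * P) = 1\<^sub>m d"
    using mult_mat_assoc4(1)[OF Q S Rc Pc] PQ RS Q by simp
  moreover have "Q * S \<in> carrier_mat d d" by (rule mult_carrier_mat[OF Q S])
  ultimately show ?thesis unfolding isomorphic_iff df[symmetric] by blast
qed

text \<open>With an intertwiner \<open>P\<close> and its inverse \<open>Q\<close>,
  \<open>\<rho> g = Q * \<sigma> g * P\<close>, and the outer factors do not depend on g.\<close>

lemma orth_coeffs_isomorphic:
  assumes orth: "orth_coeffs f e \<sigma>" and iso: "isomorphic_representations G d \<rho> e \<sigma>"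
    and rep: "representation G d \<rho>" "representation G e \<sigma>"
  shows "orth_coeffs f d \<rho>"
proof -
  obtain P Q where P: "intertwiner d \<rho> d \<sigma> P" and de: "d = e" and Q: "Q \<in> carrier_mat d d"
    and PQ: "Q * P = 1\<^sub>m d"
    using iso by (auto simp: isomorphic_iff)
  have Pc: "P \<in> carrier_mat d d" using P by (simp add: intertwiner_def)
  have \<sigma>c: "\<sigma> g \<in> carrier_mat d d" if "g \<in> carrier G" for g
    using representationD(1)[OF rep(2) that] de by simp
  have conj: "\<rho> g = Q * \<sigma> g * P" if g: "g \<in> carrier G" for g
  proof -
    have c: "\<rho> g \<in> carrier_mat d d" using representationD(1)[OF rep(1) g] .
    have "\<rho> g = Q * P * \<rho> g" using PQ c by simp
    also have "\<dots> = Q * (P * \<rho> g)" by (rule assoc_mult_mat[OF Q Pc c])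
    also have "P * \<rho> g = \<sigma> g * P" using P g by (simp add: intertwiner_def)
    also have "Q * (\<sigma> g * P) = Q * \<sigma> g * P" by (rule assoc_mult_mat[OF Q \<sigma>c[OF g] Pc, symmetric])
    finally show ?thesis .
  qed
  show ?thesis
    unfolding orth_coeffs_def
  proof (intro allI impI)
    fix p q assume pq: "p < d" "q < d"
    have "(\<Sum>g\<in>carrier G. f g * \<rho> g $$ (p, q)) = (\<Sum>g\<in>carrier G. f g * (Q * \<sigma> g * P) $$ (p, q))"
      by (rule sum.cong[OF refl], subst conj) simp_all
    also have "\<dots> = 0"
      by (rule orth_coeffs_triple_mult[OF orth[folded de] \<sigma>c Q Pc pq])
    finally show "(\<Sum>g\<in>carrier G. f g * \<rho> g $$ (p, q)) = 0" .
  qed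
qed

section \<open>Schur's lemma\<close>

lemma invariant_kernel:
  assumes P: "intertwiner d \<rho> e \<sigma> P" and rep: "representation G d \<rho>" "representation G e \<sigma>"
  shows "invariant d \<rho> {x \<in> carrier_vec d. P *\<^sub>v x = 0\<^sub>v e}"
  unfolding invariant_def
proof (intro conjI ballI)
  have Pc: "P \<in> carrier_mat e d" using P by (simp add: intertwiner_def)
  then show "lin_subspace d {x \<in> carrier_vec d. P *\<^sub>v x = 0\<^sub>v e}"
    by (auto simp: lin_subspace_def mult_mat_zero_vec mult_add_distrib_mat_vec[of _ e d] mult_mat_vec[of _ e d])
  fix g w assume g: "g \<in> carrier G" and w: "w \<in> {x \<in> carrier_vec d. P *\<^sub>v x = 0\<^sub>v e}"
  have c: "\<rho> g \<in> carrier_mat d d" "\<sigma> g \<in> carrier_mat e e"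
    using representationD(1)[OF rep(1) g] representationD(1)[OF rep(2) g] .
  have w: "w \<in> carrier_vec d" "P *\<^sub>v w = 0\<^sub>v e" using w by auto
  have "P *\<^sub>v (\<rho> g *\<^sub>v w) = P * \<rho> g *\<^sub>v w" by (rule assoc_mult_mat_vec[OF Pc c(1) w(1), symmetric])
  also have "P * \<rho> g = \<sigma> g * P" using P g by (simp add: intertwiner_def)
  also have "\<sigma> g * P *\<^sub>v w = \<sigma> g *\<^sub>v (P *\<^sub>v w)" by (rule assoc_mult_mat_vec[OF c(2) Pc w(1)])
  also have "\<dots> = 0\<^sub>v e" unfolding w(2) by (rule mult_mat_zero_vec[OF c(2)])
  finally show "\<rho> g *\<^sub>v w \<in> {x \<in> carrier_vec d. P *\<^sub>v x = 0\<^sub>v e}"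
    using mult_mat_vec_carrier[OF c(1) w(1)] by simp
qed

lemma invariant_image:
  assumes P: "intertwiner d \<rho> e \<sigma> P" and rep: "representation G d \<rho>" "representation G e \<sigma>"
  shows "invariant e \<sigma> ((*\<^sub>v) P ` carrier_vec d)"
  unfolding invariant_def
proof (intro conjI ballI)
  have Pc: "P \<in> carrier_mat e d" using P by (simp add: intertwiner_def)
  show "lin_subspace e ((*\<^sub>v) P ` carrier_vec d)"
    unfolding lin_subspace_def
  proof (intro conjI ballI allI)
    show "(*\<^sub>v) P ` carrier_vec d \<subseteq> carrier_vec e"
      by (intro image_subsetI mult_mat_vec_carrier[OF Pc])
    show "0\<^sub>v e \<in> (*\<^sub>v) P ` carrier_vec d"
      by (rule image_eqI[of _ _ "0\<^sub>v d"]) (simp_all add: mult_mat_zero_vec[OF Pc])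
    fix v assume "v \<in> (*\<^sub>v) P ` carrier_vec d"
    then obtain x where x: "v = P *\<^sub>v x" "x \<in> carrier_vec d" by auto
    show "c \<cdot>\<^sub>v v \<in> (*\<^sub>v) P ` carrier_vec d" for c
      by (rule image_eqI[of _ _ "c \<cdot>\<^sub>v x"]) (use x in \<open>simp_all add: mult_mat_vec[OF Pc]\<close>)
    fix w assume "w \<in> (*\<^sub>v) P ` carrier_vec d"
    then obtain y where y: "w = P *\<^sub>v y" "y \<in> carrier_vec d" by auto
    show "v + w \<in> (*\<^sub>v) P ` carrier_vec d"
      by (rule image_eqI[of _ _ "x + y"]) (use x y in \<open>simp_all add: mult_add_distrib_mat_vec[OF Pc]\<close>)
  qed
  fix g w assume g: "g \<in> carrier G" and "w \<in> (*\<^sub>v) P ` carrier_vec d"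
  then obtain x where x: "w = P *\<^sub>v x" "x \<in> carrier_vec d" by auto
  have c: "\<rho> g \<in> carrier_mat d d" "\<sigma> g \<in> carrier_mat e e"
    using representationD(1)[OF rep(1) g] representationD(1)[OF rep(2) g] .
  have "\<sigma> g *\<^sub>v w = \<sigma> g * P *\<^sub>v x" unfolding x(1) by (rule assoc_mult_mat_vec[OF c(2) Pc x(2), symmetric])
  also have "\<sigma> g * P = P * \<rho> g" using P g by (simp add: intertwiner_def)
  also have "P * \<rho> g *\<^sub>v x = P *\<^sub>v (\<rho> g *\<^sub>v x)" by (rule assoc_mult_mat_vec[OF Pc c(1) x(2)])
  finally show "\<sigma> g *\<^sub>v w \<in> (*\<^sub>v) P ` carrier_vec d"
    using mult_mat_vec_carrier[OF c(1) x(2)] by blast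
qed

lemma irreducibleD:
  assumes "irreducible_representation G d \<rho>"
  shows "representation G d \<rho>" "d > 0" "invariant d \<rho> W \<Longrightarrow> W = {0\<^sub>v d} \<or> W = carrier_vec d"
  using assms by (auto simp: irreducible_iff)

text \<open>The kernel is invariant, so a single nonzero vector in it makes it the whole space. This
  gives injectivity in \<open>schur_isomorphic\<close> and is applied to an eigenvector in
  \<open>schur_scalar\<close>.\<close>

lemma intertwiner_zero_or_inj:
  assumes P: "intertwiner d \<rho> e \<sigma> P"
    and \<rho>: "irreducible_representation G d \<rho>" and \<sigma>: "representation G e \<sigma>"
    and x: "x \<in> carrier_vec d" "P *\<^sub>v x = 0\<^sub>v e" "x \<noteq> 0\<^sub>v d"
  shows "P = 0\<^sub>m e d"
proof -
  have "{x \<in> carrier_vec d. P *\<^sub>v x = 0\<^sub>v e} = carrier_vec d"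
    using irreducibleD(3)[OF \<rho> invariant_kernel[OF P irreducibleD(1)[OF \<rho>] \<sigma>]] x by blast
  then have "P *\<^sub>v y = 0\<^sub>v e" if "y \<in> carrier_vec d" for y using that by blast
  then show ?thesis
    using P by (intro mat_eqI_vec[of _ e d]) (auto simp: intertwiner_def zero_mat_mult_vec)
qed

lemma schur_isomorphic:
  assumes P: "intertwiner d \<rho> e \<sigma> P" and nz: "P \<noteq> 0\<^sub>m e d"
    and \<rho>: "irreducible_representation G d \<rho>" and \<sigma>: "irreducible_representation G e \<sigma>"
  shows "isomorphic_representations G d \<rho> e \<sigma>"
proof -
  note rep = irreducibleD(1)[OF \<rho>] irreducibleD(1)[OF \<sigma>]
  have Pc: "P \<in> carrier_mat e d" using P by (simp add: intertwiner_def)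
  have inj: "x = 0\<^sub>v d" if "x \<in> carrier_vec d" "P *\<^sub>v x = 0\<^sub>v e" for x
    using intertwiner_zero_or_inj[OF P \<rho> rep(2) that] nz by blast
  have "(*\<^sub>v) P ` carrier_vec d \<noteq> {0\<^sub>v e}"
  proof
    assume "(*\<^sub>v) P ` carrier_vec d = {0\<^sub>v e}"
    then have "P *\<^sub>v x = 0\<^sub>v e" if "x \<in> carrier_vec d" for x using that by blast
    then have "P = 0\<^sub>m e d"
      using Pc by (intro mat_eqI_vec[of _ e d]) (auto simp: zero_mat_mult_vec)
    then show False using nz by contradiction
  qed
  then have surj: "(*\<^sub>v) P ` carrier_vec d = carrier_vec e"
    using irreducibleD(3)[OF \<sigma> invariant_image[OF P rep]] by blast
  have "\<forall>j. \<exists>x\<in>carrier_vec d. P *\<^sub>v x = unit_vec e j"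
    using surj unit_vec_carrier by (metis imageE)
  then obtain x where x: "\<And>j. x j \<in> carrier_vec d" "\<And>j. P *\<^sub>v x j = unit_vec e j" by metis
  \<comment> \<open>The columns of the inverse are preimages of the unit vectors; that it is also a
    left inverse comes from injectivity of \<open>P\<close>.\<close>
  define Q where "Q = mat d e (\<lambda>(i, j). x j $ i)"
  have Qc: "Q \<in> carrier_mat d e" by (simp add: Q_def)
  have PQ: "P * Q = 1\<^sub>m e"
  proof (rule eq_matI)
    fix i j assume "i < dim_row (1\<^sub>m e :: complex mat)" "j < dim_col (1\<^sub>m e :: complex mat)"
    then have ij: "i < e" "j < e" by auto
    have "(P * Q) $$ (i, j) = (\<Sum>k<d. P $$ (i, k) * x j $ k)"
      using ij by (subst mult_mat_index[OF Pc Qc]) (auto simp: Q_def)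
    also have "\<dots> = (P *\<^sub>v x j) $ i"
      using ij by (subst mult_mat_vec_index[OF Pc x(1)]) auto
    finally show "(P * Q) $$ (i, j) = 1\<^sub>m e $$ (i, j)" using x(2) ij by simp
  qed (use Pc Qc in auto)
  have QP: "Q * P = 1\<^sub>m d"
  proof (rule mat_eqI_vec[of _ d d])
    fix y :: "complex vec" assume y: "y \<in> carrier_vec d"
    have Py: "P *\<^sub>v y \<in> carrier_vec e" by (rule mult_mat_vec_carrier[OF Pc y])
    have QPy: "Q *\<^sub>v (P *\<^sub>v y) \<in> carrier_vec d" by (rule mult_mat_vec_carrier[OF Qc Py])
    have "P *\<^sub>v (Q *\<^sub>v (P *\<^sub>v y)) = P *\<^sub>v y"
      unfolding assoc_mult_mat_vec[OF Pc Qc Py, symmetric] PQ by (rule one_mult_mat_vec[OF Py])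
    then have "P *\<^sub>v (Q *\<^sub>v (P *\<^sub>v y) - y) = 0\<^sub>v e"
      unfolding mult_minus_distrib_mat_vec[OF Pc QPy y] using Py by simp
    then have 0: "Q *\<^sub>v (P *\<^sub>v y) - y = 0\<^sub>v d" using QPy y by (intro inj) auto
    have "Q *\<^sub>v (P *\<^sub>v y) = y"
    proof (rule eq_vecI)
      fix i assume "i < dim_vec y"
      then have "(Q *\<^sub>v (P *\<^sub>v y) - y) $ i = 0" unfolding 0 using y by simp
      then show "(Q *\<^sub>v (P *\<^sub>v y)) $ i = y $ i" using \<open>i < dim_vec y\<close> by (simp only: index_minus_vec) simp
    qed (use QPy y Qc in auto)
    then show "Q * P *\<^sub>v y = 1\<^sub>m d *\<^sub>v y"
      unfolding assoc_mult_mat_vec[OF Qc Pc y] using y by simp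
  qed (use Pc Qc in auto)
  \<comment> \<open>The dimensions agree because \<open>Q * P\<close> and \<open>P * Q\<close> are
    identity matrices with the same trace.\<close>
  have "of_nat d = (\<Sum>k<d. (Q * P) $$ (k, k))" using QP by simp
  also have "\<dots> = (\<Sum>k<d. \<Sum>i<e. Q $$ (k, i) * P $$ (i, k))"
    by (intro sum.cong refl) (simp only: mult_mat_index[OF Qc Pc] lessThan_iff)
  also have "\<dots> = (\<Sum>i<e. \<Sum>k<d. P $$ (i, k) * Q $$ (k, i))"
    by (subst sum.swap) (simp only: mult.commute)
  also have "\<dots> = (\<Sum>i<e. (P * Q) $$ (i, i))"
    by (intro sum.cong refl) (simp only: mult_mat_index[OF Pc Qc] lessThan_iff)
  also have "\<dots> = of_nat e" using PQ by simp
  finally have "d = e" using of_nat_eq_iff by blast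
  then show ?thesis using P Qc PQ QP unfolding isomorphic_iff by blast
qed

text \<open>As d > 0, \<open>P\<close> has a complex eigenvalue c. Then
  \<open>P - c \<cdot>\<^sub>m 1\<^sub>m d\<close> is an intertwiner that kills an eigenvector, so
  it vanishes.\<close>

lemma schur_scalar:
  assumes P: "intertwiner d \<rho> d \<rho> P" and \<rho>: "irreducible_representation G d \<rho>"
  obtains c where "P = c \<cdot>\<^sub>m 1\<^sub>m d"
proof -
  note rep = irreducibleD(1)[OF \<rho>]
  have Pc: "P \<in> carrier_mat d d" using P by (simp add: intertwiner_def)
  obtain c v where v: "v \<in> carrier_vec d" "v \<noteq> 0\<^sub>v d" "P *\<^sub>v v = c \<cdot>\<^sub>v v"
    using spectrum_non_empty[OF Pc irreducibleD(2)[OF \<rho>]] Pc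
    by (auto simp: spectrum_def eigenvalue_def eigenvector_def)
  define R where "R = P - c \<cdot>\<^sub>m 1\<^sub>m d"
  have Rc: "R \<in> carrier_mat d d" using Pc by (simp add: R_def minus_carrier_mat)
  have "intertwiner d \<rho> d \<rho> R"
    unfolding intertwiner_def
  proof (intro conjI ballI)
    fix g assume g: "g \<in> carrier G"
    have c: "\<rho> g \<in> carrier_mat d d" by (rule representationD(1)[OF rep g])
    have "R * \<rho> g = P * \<rho> g - c \<cdot>\<^sub>m 1\<^sub>m d * \<rho> g"
      unfolding R_def using Pc c by (intro minus_mult_distrib_mat) auto
    also have "c \<cdot>\<^sub>m 1\<^sub>m d * \<rho> g = c \<cdot>\<^sub>m \<rho> g"
      using c by (subst mult_smult_assoc_mat[of _ d d]) auto
    also have "P * \<rho> g = \<rho> g * P" using P g by (simp add: intertwiner_def)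
    also have "c \<cdot>\<^sub>m \<rho> g = \<rho> g * (c \<cdot>\<^sub>m 1\<^sub>m d)"
      using c by (subst mult_smult_distrib[of _ d d]) auto
    also have "\<rho> g * P - \<rho> g * (c \<cdot>\<^sub>m 1\<^sub>m d) = \<rho> g * R"
      unfolding R_def using Pc c by (intro mult_minus_distrib_mat[symmetric]) auto
    finally show "R * \<rho> g = \<rho> g * R" .
  qed (rule Rc)
  moreover have "R *\<^sub>v v = 0\<^sub>v d"
  proof (rule eq_vecI)
    fix i assume "i < dim_vec (0\<^sub>v d :: complex vec)"
    then have i: "i < d" by simp
    have "(R *\<^sub>v v) $ i = (\<Sum>k<d. R $$ (i, k) * v $ k)" by (rule mult_mat_vec_index[OF Rc v(1) i])
    also have "\<dots> = (\<Sum>k<d. P $$ (i, k) * v $ k - (if i = k then c * v $ k else 0))"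
      using i Pc by (intro sum.cong) (auto simp: R_def algebra_simps)
    also have "\<dots> = (P *\<^sub>v v) $ i - c * v $ i"
      using i by (simp add: sum_subtractf mult_mat_vec_index[OF Pc v(1) i])
    finally show "(R *\<^sub>v v) $ i = 0\<^sub>v d $ i" using v i by simp
  qed (use Rc in auto)
  ultimately have "R = 0\<^sub>m d d" using intertwiner_zero_or_inj[OF _ \<rho> rep v(1)] v(2) by blast
  then have "P $$ (i, j) = (c \<cdot>\<^sub>m 1\<^sub>m d) $$ (i, j)" if "i < d" "j < d" for i j
  proof -
    have "R $$ (i, j) = 0" using that \<open>R = 0\<^sub>m d d\<close> by simp
    moreover have "R $$ (i, j) = P $$ (i, j) - (c \<cdot>\<^sub>m 1\<^sub>m d) $$ (i, j)"
      unfolding R_def using that by (intro index_minus_mat(1)) auto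
    ultimately show ?thesis by simp
  qed
  then have "P = c \<cdot>\<^sub>m 1\<^sub>m d" using Pc by (intro eq_matI) auto
  then show thesis by (rule that)
qed

section \<open>Orthogonality relations by averaging over the group\<close>

lemma sum_carrier_translate:
  "h \<in> carrier G \<Longrightarrow> (\<Sum>g\<in>carrier G. F (h \<otimes> g)) = (\<Sum>g\<in>carrier G. F g)"
  by (rule sum.reindex_bij_witness[of _ "\<lambda>g. inv h \<otimes> g" "\<lambda>g. h \<otimes> g"]) (auto simp: m_assoc[symmetric])

lemma sum_carrier_inv: "(\<Sum>g\<in>carrier G. F (inv g)) = (\<Sum>g\<in>carrier G. F g)"
  by (rule sum.reindex_bij_witness[of _ "\<lambda>g. inv g" "\<lambda>g. inv g"]) auto

text \<open>Entrywise form of the average of \<open>\<sigma> g * E * \<rho> (inv g)\<close> over the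
  group, up to the factor n, where E is the matrix unit at (r, s). Each choice of E thus yields one
  family of orthogonality relations.\<close>

lemma intertwiner_average:
  assumes rep: "representation G d \<rho>" "representation G e \<sigma>" and rs: "r < e" "s < d"
  shows "intertwiner d \<rho> e \<sigma> (mat e d (\<lambda>(p, q). \<Sum>g\<in>carrier G. \<sigma> g $$ (p, r) * \<rho> (inv g) $$ (s, q)))"
    (is "intertwiner _ _ _ _ ?P")
  unfolding intertwiner_def
proof (intro conjI ballI)
  show Pc: "?P \<in> carrier_mat e d" by simp
  fix h assume h: "h \<in> carrier G"
  note \<rho>c = representationD(1)[OF rep(1)] and \<sigma>c = representationD(1)[OF rep(2)]
  show "?P * \<rho> h = \<sigma> h * ?P"
  proof (rule eq_matI)
    fix p q assume "p < dim_row (\<sigma> h * ?P)" "q < dim_col (\<sigma> h * ?P)"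
    then have pq: "p < e" "q < d" using \<sigma>c[OF h] by auto
    have "(?P * \<rho> h) $$ (p, q) =
        (\<Sum>k<d. (\<Sum>g\<in>carrier G. \<sigma> g $$ (p, r) * \<rho> (inv g) $$ (s, k)) * \<rho> h $$ (k, q))"
      using pq by (subst mult_mat_index[OF Pc \<rho>c[OF h]]) auto
    also have "\<dots> = (\<Sum>g\<in>carrier G. \<sigma> g $$ (p, r) * (\<Sum>k<d. \<rho> (inv g) $$ (s, k) * \<rho> h $$ (k, q)))"
      unfolding sum_distrib_left sum_distrib_right by (subst sum.swap) (simp only: mult.assoc)
    also have "\<dots> = (\<Sum>g\<in>carrier G. \<sigma> g $$ (p, r) * \<rho> (inv g \<otimes> h) $$ (s, q))"
      using pq rs h representationD(3)[OF rep(1)] \<rho>c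
      by (intro sum.cong refl) (simp add: mult_mat_index[of _ d d _ d] del: index_mult_mat(1))
    \<comment> \<open>Replacing g by \<open>h \<otimes> g\<close> moves h from the right factor to
      the left one, since \<open>inv (h \<otimes> g) \<otimes> h = inv g\<close>.\<close>
    also have "\<dots> = (\<Sum>g\<in>carrier G. \<sigma> (h \<otimes> g) $$ (p, r) * \<rho> (inv (h \<otimes> g) \<otimes> h) $$ (s, q))"
      by (rule sum_carrier_translate[OF h, symmetric])
    also have "\<dots> = (\<Sum>g\<in>carrier G. (\<Sum>k<e. \<sigma> h $$ (p, k) * \<sigma> g $$ (k, r)) * \<rho> (inv g) $$ (s, q))"
    proof (rule sum.cong[OF refl])
      fix g assume g: "g \<in> carrier G"
      have "inv (h \<otimes> g) \<otimes> h = inv g" using g h by (simp add: inv_mult_group m_assoc)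
      then show "\<sigma> (h \<otimes> g) $$ (p, r) * \<rho> (inv (h \<otimes> g) \<otimes> h) $$ (s, q) =
          (\<Sum>k<e. \<sigma> h $$ (p, k) * \<sigma> g $$ (k, r)) * \<rho> (inv g) $$ (s, q)"
        using mult_mat_index[OF \<sigma>c[OF h] \<sigma>c[OF g] pq(1) rs(1)] representationD(3)[OF rep(2) h g]
        by simp
    qed
    also have "\<dots> = (\<Sum>k<e. \<sigma> h $$ (p, k) * (\<Sum>g\<in>carrier G. \<sigma> g $$ (k, r) * \<rho> (inv g) $$ (s, q)))"
      unfolding sum_distrib_left sum_distrib_right by (subst sum.swap) (simp only: mult.assoc)
    also have "\<dots> = (\<sigma> h * ?P) $$ (p, q)"
      using pq by (subst mult_mat_index[OF \<sigma>c[OF h] Pc]) auto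
    finally show "(?P * \<rho> h) $$ (p, q) = (\<sigma> h * ?P) $$ (p, q)" .
  qed (use \<rho>c[OF h] \<sigma>c[OF h] in auto)
qed

lemma schur_orthogonality_nonisomorphic:
  assumes \<rho>: "irreducible_representation G d \<rho>" and \<sigma>: "irreducible_representation G e \<sigma>"
    and "\<not> isomorphic_representations G d \<rho> e \<sigma>"
    and pq: "p < e" "r < e" "s < d" "q < d"
  shows "(\<Sum>g\<in>carrier G. \<sigma> g $$ (p, r) * \<rho> (inv g) $$ (s, q)) = 0"
proof -
  let ?P = "mat e d (\<lambda>(p, q). \<Sum>g\<in>carrier G. \<sigma> g $$ (p, r) * \<rho> (inv g) $$ (s, q))"
  have "intertwiner d \<rho> e \<sigma> ?P"
    by (rule intertwiner_average[OF irreducibleD(1)[OF \<rho>] irreducibleD(1)[OF \<sigma>] pq(2,3)])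
  then have "?P = 0\<^sub>m e d" using schur_isomorphic[OF _ _ \<rho> \<sigma>] assms(3) by blast
  from arg_cong[OF this, of "\<lambda>A. A $$ (p, q)"] show ?thesis using pq by simp
qed

lemma schur_orthogonality:
  assumes \<rho>: "irreducible_representation G d \<rho>" and pq: "p < d" "r < d" "s < d" "q < d"
  shows "(\<Sum>g\<in>carrier G. \<rho> g $$ (p, r) * \<rho> (inv g) $$ (s, q)) =
    (if p = q \<and> r = s then of_nat (card (carrier G)) / of_nat d else 0)"
proof -
  note rep = irreducibleD(1)[OF \<rho>]
  note \<rho>c = representationD(1)[OF rep]
  define F where "F p q = (\<Sum>g\<in>carrier G. \<rho> g $$ (p, r) * \<rho> (inv g) $$ (s, q))" for p q
  let ?P = "mat d d (\<lambda>(p, q). F p q)"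
  have "intertwiner d \<rho> d \<rho> ?P"
    unfolding F_def by (rule intertwiner_average[OF rep rep pq(2,3)])
  then obtain c where c: "?P = c \<cdot>\<^sub>m 1\<^sub>m d" using schur_scalar[OF _ \<rho>] by metis
  have F: "F i j = (if i = j then c else 0)" if "i < d" "j < d" for i j
    using arg_cong[OF c, of "\<lambda>A. A $$ (i, j)"] that by simp
  \<comment> \<open>The trace determines the scalar c: summing over the diagonal collapses each term
    to an entry of \<open>\<rho> (inv g) * \<rho> g\<close>, the identity matrix.\<close>
  have "of_nat d * c = (\<Sum>i<d. F i i)" using F by simp
  also have "\<dots> = (\<Sum>g\<in>carrier G. \<Sum>i<d. \<rho> (inv g) $$ (s, i) * \<rho> g $$ (i, r))"
    unfolding F_def by (subst sum.swap) (simp only: mult.commute)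
  also have "\<dots> = (\<Sum>g\<in>carrier G. 1\<^sub>m d $$ (s, r))"
  proof (rule sum.cong[OF refl])
    fix g assume g: "g \<in> carrier G"
    have "(\<Sum>i<d. \<rho> (inv g) $$ (s, i) * \<rho> g $$ (i, r)) = (\<rho> (inv g) * \<rho> g) $$ (s, r)"
      using mult_mat_index[OF \<rho>c[OF inv_closed[OF g]] \<rho>c[OF g] pq(3,2)] by simp
    also have "\<rho> (inv g) * \<rho> g = 1\<^sub>m d"
      using representationD(3)[OF rep inv_closed[OF g] g] representationD(2)[OF rep] g by simp
    finally show "(\<Sum>i<d. \<rho> (inv g) $$ (s, i) * \<rho> g $$ (i, r)) = 1\<^sub>m d $$ (s, r)" .
  qed
  also have "\<dots> = (if r = s then of_nat (card (carrier G)) else 0)" using pq by simp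
  finally have "c = (if r = s then of_nat (card (carrier G)) / of_nat d else 0)"
    using irreducibleD(2)[OF \<rho>] by (auto simp: field_simps)
  then show ?thesis using F[OF pq(1,4)] by (auto simp: F_def)
qed

section \<open>Unitary forms and the character of the regular representation\<close>

lemma unitary_irrepD:
  assumes "unitary_irrep d \<tau>"
  shows "irreducible_representation G d \<tau>" "representation G d \<tau>"
    "g \<in> carrier G \<Longrightarrow> \<tau> (inv g) = adj (\<tau> g)"
  using assms by (auto simp: unitary_irrep_def unitary_rep_def)

text \<open>Otherwise the coefficients of \<open>\<rho>\<close> would be orthogonal to those of all unitary
  representations, including the regular one.\<close>

lemma irreducible_isomorphic_unitary:
  assumes \<rho>: "irreducible_representation G d \<rho>"
  obtains \<tau> where "unitary_irrep d \<tau>" "isomorphic_representations G d \<rho> d \<tau>"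
proof (rule ccontr)
  assume "\<not> thesis"
  then have non: "\<not> isomorphic_representations G d \<rho> e \<tau>" if "unitary_irrep e \<tau>" for e \<tau>
    using that isomorphic_dim \<open>\<And>\<tau>. unitary_irrep d \<tau> \<Longrightarrow> isomorphic_representations G d \<rho> d \<tau> \<Longrightarrow> thesis\<close> by metis
  have d: "d > 0" by (rule irreducibleD(2)[OF \<rho>])
  \<comment> \<open>This coefficient is chosen because its value at \<open>\<one>\<close> is 1, so
    completeness, which would make it vanish, gives the contradiction.\<close>
  have "orth_coeffs (\<lambda>g. \<rho> (inv g) $$ (0, 0)) e \<tau>" if \<tau>: "unitary_irrep e \<tau>" for e \<tau>
    using schur_orthogonality_nonisomorphic[OF \<rho> unitary_irrepD(1)[OF \<tau>] non[OF \<tau>]] d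
    by (simp add: orth_coeffs_def mult.commute)
  then have "\<rho> (inv \<one>) $$ (0, 0) = 0" using orth_coeffs_imp_zero one_closed by blast
  then show False using d representationD(2)[OF irreducibleD(1)[OF \<rho>]] by simp
qed

text \<open>Column orthogonality at the identity. By Schur orthogonality, the indicator of
  \<open>\<one>\<close> scaled by n and the reflected character sum have the same pairing with every
  coefficient, namely n on the diagonal and 0 off it; completeness then makes the two functions
  equal.\<close>

lemma sum_dim_character:
  assumes U: "\<And>i. i \<in> I \<Longrightarrow> unitary_irrep (d i) (U i)" and I: "finite I"
    and distinct: "\<And>i j. i \<in> I \<Longrightarrow> j \<in> I \<Longrightarrow> i \<noteq> j \<Longrightarrow>
      \<not> isomorphic_representations G (d i) (U i) (d j) (U j)"
    and complete: "\<And>e \<tau>. unitary_irrep e \<tau> \<Longrightarrow> \<exists>i\<in>I. isomorphic_representations G e \<tau> (d i) (U i)"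
    and x: "x \<in> carrier G"
  shows "(\<Sum>i\<in>I. of_nat (d i) * (\<Sum>p<d i. U i x $$ (p, p))) =
    (if x = \<one> then of_nat (card (carrier G)) else 0)"
proof -
  let ?n = "of_nat (card (carrier G)) :: complex"
  have n: "?n \<noteq> 0" using finite_carrier one_closed by auto
  define \<chi> where "\<chi> g = (\<Sum>i\<in>I. of_nat (d i) * (\<Sum>p<d i. U i g $$ (p, p)))" for g
  \<comment> \<open>The inverse inside the character sum brings each pairing into the shape of the
    orthogonality relations; it is undone at the end by evaluating at \<open>inv x\<close>.\<close>
  define f where "f g = (if g = \<one> then ?n else 0) - \<chi> (inv g)" for g
  have fU: "orth_coeffs f (d i) (U i)" if i: "i \<in> I" for i
    unfolding orth_coeffs_def
  proof (intro allI impI)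
    fix p q assume pq: "p < d i" "q < d i"
    have di: "d i > 0" using irreducibleD(2)[OF unitary_irrepD(1)[OF U[OF i]]] .
    have "(\<Sum>g\<in>carrier G. \<chi> (inv g) * U i g $$ (p, q)) =
        (\<Sum>j\<in>I. of_nat (d j) * (\<Sum>r<d j. \<Sum>g\<in>carrier G. U i g $$ (p, q) * U j (inv g) $$ (r, r)))"
    proof -
      have "(\<Sum>g\<in>carrier G. \<chi> (inv g) * U i g $$ (p, q)) =
          (\<Sum>g\<in>carrier G. \<Sum>j\<in>I. \<Sum>r<d j. of_nat (d j) * (U i g $$ (p, q) * U j (inv g) $$ (r, r)))"
        unfolding \<chi>_def sum_distrib_left sum_distrib_right by (intro sum.cong refl) (simp only: mult_ac)
      also have "\<dots> = (\<Sum>j\<in>I. \<Sum>r<d j. \<Sum>g\<in>carrier G. of_nat (d j) * (U i g $$ (p, q) * U j (inv g) $$ (r, r)))"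
        by (subst sum.swap, intro sum.cong refl, subst sum.swap, rule refl)
      finally show ?thesis by (simp only: sum_distrib_left)
    qed
    also have "\<dots> = (\<Sum>j\<in>I. if j = i then (if p = q then ?n else 0) else 0)"
    proof (rule sum.cong[OF refl])
      fix j assume j: "j \<in> I"
      show "of_nat (d j) * (\<Sum>r<d j. \<Sum>g\<in>carrier G. U i g $$ (p, q) * U j (inv g) $$ (r, r)) =
          (if j = i then (if p = q then ?n else 0) else 0)"
      proof (cases "j = i")
        case True
        have "(\<Sum>r<d i. \<Sum>g\<in>carrier G. U i g $$ (p, q) * U i (inv g) $$ (r, r)) =
            (\<Sum>r<d i. if r = p then (if p = q then ?n / of_nat (d i) else 0) else 0)"
          using schur_orthogonality[OF unitary_irrepD(1)[OF U[OF i]] pq] by (intro sum.cong) auto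
        also have "\<dots> = (if p = q then ?n / of_nat (d i) else 0)" using pq by simp
        finally show ?thesis using True di by simp
      next
        case False
        have "(\<Sum>g\<in>carrier G. U i g $$ (p, q) * U j (inv g) $$ (r, r)) = 0" if "r < d j" for r
          using schur_orthogonality_nonisomorphic[OF unitary_irrepD(1)[OF U[OF j]] unitary_irrepD(1)[OF U[OF i]]
            distinct[OF j i False] pq that that] .
        then show ?thesis using False by simp
      qed
    qed
    also have "\<dots> = (if p = q then ?n else 0)" using i I by simp
    finally have "(\<Sum>g\<in>carrier G. \<chi> (inv g) * U i g $$ (p, q)) = (if p = q then ?n else 0)" .
    moreover have "(\<Sum>g\<in>carrier G. (if g = \<one> then ?n else 0) * U i g $$ (p, q)) = (if p = q then ?n else 0)"
    proof -
      have "(\<Sum>g\<in>carrier G. (if g = \<one> then ?n else 0) * U i g $$ (p, q)) =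
          (\<Sum>g\<in>carrier G. if g = \<one> then ?n * U i \<one> $$ (p, q) else 0)"
        by (intro sum.cong) auto
      also have "\<dots> = ?n * U i \<one> $$ (p, q)" using finite_carrier by simp
      finally show ?thesis using representationD(2)[OF unitary_irrepD(2)[OF U[OF i]]] pq by simp
    qed
    ultimately show "(\<Sum>g\<in>carrier G. f g * U i g $$ (p, q)) = 0"
      by (simp add: f_def left_diff_distrib sum_subtractf)
  qed
  have "orth_coeffs f e \<tau>" if \<tau>: "unitary_irrep e \<tau>" for e \<tau>
  proof -
    obtain i where i: "i \<in> I" "isomorphic_representations G e \<tau> (d i) (U i)" using complete[OF \<tau>] by blast
    show ?thesis
      by (rule orth_coeffs_isomorphic[OF fU[OF i(1)] i(2) unitary_irrepD(2)[OF \<tau>] unitary_irrepD(2)[OF U[OF i(1)]]])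
  qed
  then have "f (inv x) = 0" using orth_coeffs_imp_zero inv_closed[OF x] by blast
  moreover have "inv x = \<one> \<longleftrightarrow> x = \<one>" using x by (metis inv_inv inv_one)
  ultimately show ?thesis using x by (auto simp: f_def \<chi>_def split: if_splits)
qed

end

section \<open>Inequalities for pure tensors\<close>

lemma l2_norm_nonneg [simp]: "0 \<le> l2_norm A x"
  by (simp add: l2_norm_def sum_nonneg)

lemma l2_norm_square: "(l2_norm A x)\<^sup>2 = (\<Sum>a\<in>A. (cmod (x a))\<^sup>2)"
  by (simp add: l2_norm_def sum_nonneg)

lemma l2_norm_eq_L2_set: "l2_norm A x = L2_set (\<lambda>a. cmod (x a)) A"
  by (simp add: l2_norm_def L2_set_def)

lemma cauchy_schwarz: "cmod (\<Sum>a\<in>A. f a * g a) \<le> l2_norm A f * l2_norm A g"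
proof -
  have "cmod (\<Sum>a\<in>A. f a * g a) \<le> (\<Sum>a\<in>A. \<bar>cmod (f a)\<bar> * \<bar>cmod (g a)\<bar>)"
    by (rule order_trans[OF norm_sum]) (simp add: norm_mult)
  also have "\<dots> \<le> l2_norm A f * l2_norm A g"
    unfolding l2_norm_eq_L2_set by (rule L2_set_mult_ineq)
  finally show ?thesis .
qed

lemma l2_norm_scale: "l2_norm A (\<lambda>a. c * x a) = cmod c * l2_norm A x"
  by (simp add: l2_norm_def norm_mult power_mult_distrib sum_distrib_left[symmetric] real_sqrt_mult)

lemma l2_norm_tensor3: "l2_norm (A \<times> B \<times> C) (tensor3 x y z) = l2_norm A x * l2_norm B y * l2_norm C z"
proof -
  have "(\<Sum>t\<in>A \<times> B \<times> C. (cmod (tensor3 x y z t))\<^sup>2) =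
      (\<Sum>a\<in>A. \<Sum>b\<in>B. \<Sum>c\<in>C. (cmod (x a))\<^sup>2 * ((cmod (y b))\<^sup>2 * (cmod (z c))\<^sup>2))"
    unfolding tensor3_def
    by (simp add: sum.cartesian_product norm_mult power_mult_distrib mult_ac case_prod_unfold)
  also have "\<dots> = (\<Sum>a\<in>A. (cmod (x a))\<^sup>2) * ((\<Sum>b\<in>B. (cmod (y b))\<^sup>2) * (\<Sum>c\<in>C. (cmod (z c))\<^sup>2))"
    by (simp only: sum_distrib_left[symmetric] sum_distrib_right[symmetric])
  finally show ?thesis by (simp add: l2_norm_def real_sqrt_mult mult_ac)
qed

lemma l2_inner_sum_left: "l2_inner A (\<lambda>a. \<Sum>j\<in>J. f j a) y = (\<Sum>j\<in>J. l2_inner A (f j) y)"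
  unfolding l2_inner_def sum_distrib_right by (rule sum.swap)

lemma l2_inner_sum_right: "l2_inner A x (\<lambda>a. \<Sum>j\<in>J. f j a) = (\<Sum>j\<in>J. l2_inner A x (f j))"
  unfolding l2_inner_def cnj_sum sum_distrib_left by (rule sum.swap)

lemma l2_inner_scale_left: "l2_inner A (\<lambda>a. c * x a) y = c * l2_inner A x y"
  by (simp add: l2_inner_def sum_distrib_left mult.assoc)

lemma l2_inner_scale_right: "l2_inner A x (\<lambda>a. c * y a) = cnj c * l2_inner A x y"
  by (simp add: l2_inner_def sum_distrib_left mult_ac)

lemma l2_inner_self: "l2_inner A x x = complex_of_real ((l2_norm A x)\<^sup>2)"
  unfolding l2_norm_square l2_inner_def of_real_sum complex_norm_square ..

lemma l2_inner_le: "cmod (l2_inner A x y) \<le> l2_norm A x * l2_norm A y"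
  using cauchy_schwarz[of x "\<lambda>a. cnj (y a)" A] by (simp add: l2_inner_def l2_norm_def)

text \<open>For \<open>y\<close> the projection of \<open>x\<close>, both \<open>\<langle>x, y\<rangle>\<close> and \<open>\<parallel>y\<parallel>\<^sup>2\<close> equal the left-hand side,
  so Cauchy--Schwarz suffices.\<close>

lemma bessel:
  assumes J: "finite J" and on: "\<And>i j. i \<in> J \<Longrightarrow> j \<in> J \<Longrightarrow> l2_inner A (u i) (u j) = (if i = j then 1 else 0)"
  shows "(\<Sum>j\<in>J. (cmod (l2_inner A x (u j)))\<^sup>2) \<le> (l2_norm A x)\<^sup>2"
proof -
  define c where "c j = l2_inner A x (u j)" for j
  define N where "N = (\<Sum>j\<in>J. (cmod (c j))\<^sup>2)"
  define y where "y a = (\<Sum>j\<in>J. c j * u j a)" for a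
  have xy: "l2_inner A x y = complex_of_real N"
    unfolding y_def l2_inner_sum_right l2_inner_scale_right N_def of_real_sum complex_norm_square
    by (simp add: c_def mult.commute)
  have "l2_inner A (u i) y = cnj (c i)" if "i \<in> J" for i
  proof -
    have "l2_inner A (u i) y = (\<Sum>j\<in>J. if j = i then cnj (c i) else 0)"
      unfolding y_def l2_inner_sum_right l2_inner_scale_right
      using that on by (intro sum.cong) auto
    then show ?thesis using that J by simp
  qed
  moreover have "l2_inner A y z = (\<Sum>j\<in>J. c j * l2_inner A (u j) z)" for z
    unfolding y_def l2_inner_sum_left l2_inner_scale_left ..
  ultimately have "l2_inner A y y = (\<Sum>j\<in>J. c j * cnj (c j))" by simp
  then have "complex_of_real ((l2_norm A y)\<^sup>2) = complex_of_real N"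
    unfolding l2_inner_self N_def of_real_sum complex_norm_square .
  then have yN: "(l2_norm A y)\<^sup>2 = N" by (simp only: of_real_eq_iff)
  have N0: "N \<ge> 0" by (simp add: N_def sum_nonneg)
  have "N \<le> l2_norm A x * l2_norm A y"
    using l2_inner_le[of A x y] N0 by (simp add: xy)
  then have "N\<^sup>2 \<le> (l2_norm A x)\<^sup>2 * N"
    using power_mono[of N "l2_norm A x * l2_norm A y" 2] N0
    by (simp only: power_mult_distrib yN)
  then have "N * N \<le> (l2_norm A x)\<^sup>2 * N" by (simp only: power2_eq_square[of N])
  then have "N \<le> (l2_norm A x)\<^sup>2"
    using N0 by (cases "N = 0") (auto simp: mult_le_cancel_right)
  then show ?thesis by (simp add: N_def c_def)
qed

text \<open>The left side is |tr(XYZ)|. Cauchy-Schwarz pairs the product \<open>W\<close> of X and Y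
  with the transpose of Z, and a second application, entry by entry, shows that the Frobenius norm
  is submultiplicative.\<close>

lemma trilinear_trace_bound:
  fixes X Y Z :: "nat \<Rightarrow> nat \<Rightarrow> complex"
  shows "cmod (\<Sum>p<d. \<Sum>q<d. \<Sum>r<d. X p q * Y q r * Z r p) \<le>
    l2_norm ({..<d} \<times> {..<d}) (case_prod X) * l2_norm ({..<d} \<times> {..<d}) (case_prod Y) *
    l2_norm ({..<d} \<times> {..<d}) (case_prod Z)"
proof -
  let ?K = "{..<d} \<times> {..<d}"
  define W where "W p r = (\<Sum>q<d. X p q * Y q r)" for p r
  define Z' where "Z' p r = Z r p" for p r
  have "(\<Sum>p<d. \<Sum>q<d. \<Sum>r<d. X p q * Y q r * Z r p) = (\<Sum>p<d. \<Sum>r<d. W p r * Z' p r)"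
    unfolding W_def Z'_def sum_distrib_right by (intro sum.cong refl sum.swap)
  also have "\<dots> = (\<Sum>t\<in>?K. case_prod W t * case_prod Z' t)"
    by (simp add: sum.cartesian_product case_prod_unfold)
  finally have 1: "cmod (\<Sum>p<d. \<Sum>q<d. \<Sum>r<d. X p q * Y q r * Z r p) \<le>
      l2_norm ?K (case_prod W) * l2_norm ?K (case_prod Z')"
    using cauchy_schwarz by metis
  have sq: "(l2_norm ?K (case_prod V))\<^sup>2 = (\<Sum>p<d. \<Sum>r<d. (cmod (V p r))\<^sup>2)" for V
    unfolding l2_norm_square by (simp add: sum.cartesian_product case_prod_unfold)
  have "(l2_norm ?K (case_prod Z'))\<^sup>2 = (l2_norm ?K (case_prod Z))\<^sup>2"
    unfolding sq Z'_def by (rule sum.swap)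
  then have Z': "l2_norm ?K (case_prod Z') = l2_norm ?K (case_prod Z)" by simp
  have "(l2_norm ?K (case_prod W))\<^sup>2 \<le>
      (\<Sum>p<d. \<Sum>r<d. (\<Sum>q<d. (cmod (X p q))\<^sup>2) * (\<Sum>q<d. (cmod (Y q r))\<^sup>2))"
    unfolding sq
  proof (intro sum_mono)
    fix p r
    have "cmod (W p r) \<le> l2_norm {..<d} (X p) * l2_norm {..<d} (\<lambda>q. Y q r)"
      unfolding W_def by (rule cauchy_schwarz)
    from power_mono[OF this norm_ge_zero, of 2]
    show "(cmod (W p r))\<^sup>2 \<le> (\<Sum>q<d. (cmod (X p q))\<^sup>2) * (\<Sum>q<d. (cmod (Y q r))\<^sup>2)"
      by (simp add: power_mult_distrib l2_norm_square)
  qed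
  also have "\<dots> = (\<Sum>p<d. \<Sum>q<d. (cmod (X p q))\<^sup>2) * (\<Sum>r<d. \<Sum>q<d. (cmod (Y q r))\<^sup>2)"
    by (simp only: sum_distrib_left[symmetric] sum_distrib_right[symmetric])
  also have "(\<Sum>r<d. \<Sum>q<d. (cmod (Y q r))\<^sup>2) = (\<Sum>q<d. \<Sum>r<d. (cmod (Y q r))\<^sup>2)"
    by (rule sum.swap)
  finally have "(l2_norm ?K (case_prod W))\<^sup>2 \<le> (l2_norm ?K (case_prod X) * l2_norm ?K (case_prod Y))\<^sup>2"
    by (simp add: power_mult_distrib sq)
  then have "l2_norm ?K (case_prod W) \<le> l2_norm ?K (case_prod X) * l2_norm ?K (case_prod Y)"
    by (rule power2_le_imp_le) simp
  then have "l2_norm ?K (case_prod W) * l2_norm ?K (case_prod Z) \<le>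
      l2_norm ?K (case_prod X) * l2_norm ?K (case_prod Y) * l2_norm ?K (case_prod Z)"
    by (rule mult_right_mono) simp
  then show ?thesis using 1 unfolding Z' by linarith
qed

text \<open>The block-diagonal version of the trace bound. The norm of each block of Z is at most
  \<gamma> and comes out of the sum; Cauchy-Schwarz over the blocks handles X and Y.\<close>

lemma block_trilinear_bound:
  fixes X Y Z :: "'i \<Rightarrow> nat \<Rightarrow> nat \<Rightarrow> complex"
  assumes I: "finite I"
    and X: "(\<Sum>i\<in>I. \<Sum>p<d i. \<Sum>q<d i. (cmod (X i p q))\<^sup>2) \<le> \<alpha>\<^sup>2" "0 \<le> \<alpha>"
    and Y: "(\<Sum>i\<in>I. \<Sum>p<d i. \<Sum>q<d i. (cmod (Y i p q))\<^sup>2) \<le> \<beta>\<^sup>2" "0 \<le> \<beta>"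
    and Z: "(\<Sum>i\<in>I. \<Sum>p<d i. \<Sum>q<d i. (cmod (Z i p q))\<^sup>2) \<le> \<gamma>\<^sup>2" "0 \<le> \<gamma>"
  shows "cmod (\<Sum>i\<in>I. \<Sum>p<d i. \<Sum>q<d i. \<Sum>r<d i. X i p q * Y i q r * Z i r p) \<le> \<alpha> * \<beta> * \<gamma>"
proof -
  define N where "N V i = l2_norm ({..<d i} \<times> {..<d i}) (case_prod (V i))" for V :: "'i \<Rightarrow> nat \<Rightarrow> nat \<Rightarrow> complex" and i
  have N0: "0 \<le> N V i" for V i by (simp add: N_def)
  have sq: "(\<Sum>p<d i. \<Sum>q<d i. (cmod (V i p q))\<^sup>2) = (N V i)\<^sup>2" for V i
    unfolding N_def l2_norm_square by (simp add: sum.cartesian_product case_prod_unfold)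
  have L2: "L2_set (N V) I \<le> c" if "(\<Sum>i\<in>I. \<Sum>p<d i. \<Sum>q<d i. (cmod (V i p q))\<^sup>2) \<le> c\<^sup>2" "0 \<le> c" for V c
    unfolding L2_set_def using that real_sqrt_le_mono[OF that(1)] by (simp add: sq)
  have Zi: "N Z i \<le> \<gamma>" if "i \<in> I" for i
    using member_le_L2_set[OF I that, of "N Z"] L2[OF Z] by linarith
  have "cmod (\<Sum>i\<in>I. \<Sum>p<d i. \<Sum>q<d i. \<Sum>r<d i. X i p q * Y i q r * Z i r p) \<le>
      (\<Sum>i\<in>I. N X i * N Y i * N Z i)"
    unfolding N_def by (rule order_trans[OF norm_sum sum_mono[OF trilinear_trace_bound]])
  also have "\<dots> \<le> (\<Sum>i\<in>I. \<bar>N X i\<bar> * \<bar>N Y i\<bar> * \<gamma>)"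
    using Zi by (intro sum_mono) (simp add: N0 mult_left_mono)
  also have "\<dots> = (\<Sum>i\<in>I. \<bar>N X i\<bar> * \<bar>N Y i\<bar>) * \<gamma>"
    by (rule sum_distrib_right[symmetric])
  also have "\<dots> \<le> L2_set (N X) I * L2_set (N Y) I * \<gamma>"
    by (rule mult_right_mono[OF L2_set_mult_ineq Z(2)])
  also have "\<dots> \<le> \<alpha> * \<beta> * \<gamma>"
    by (intro mult_right_mono mult_mono L2 X Y Z L2_set_nonneg)
  finally show ?thesis .
qed

section \<open>Pairing with the group tensor and the spectral norm\<close>

context finite_group
begin

lemma group_tensor_eq:
  "group_tensor G (a, b, c) =
    (if a \<in> carrier G \<and> b \<in> carrier G \<and> c \<in> carrier G \<and> a \<otimes> b \<otimes> c = \<one> then 1 else 0)"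
proof -
  let ?S = "{(g, h, k). g \<in> carrier G \<and> h \<in> carrier G \<and> k \<in> carrier G \<and> g \<otimes> h \<otimes> k = \<one>}"
  have "?S \<subseteq> carrier G \<times> carrier G \<times> carrier G" by auto
  then have fin: "finite ?S" using finite_carrier by (meson finite_SigmaI finite_subset)
  have "group_tensor G (a, b, c) = (\<Sum>t\<in>?S. if t = (a, b, c) then 1 else 0)"
    unfolding group_tensor_def by (intro sum.cong) (auto simp: tensor3_def basis_vec_def split: if_splits)
  also have "\<dots> = (if (a, b, c) \<in> ?S then 1 else 0)" using fin by simp
  finally show ?thesis by simp
qed

lemma l2_inner_group_tensor:
  "l2_inner (carrier G \<times> carrier G \<times> carrier G) (group_tensor G) v =
    (\<Sum>a\<in>carrier G. \<Sum>b\<in>carrier G. cnj (v (a, b, inv (a \<otimes> b))))"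
proof -
  have "l2_inner (carrier G \<times> carrier G \<times> carrier G) (group_tensor G) v =
      (\<Sum>a\<in>carrier G. \<Sum>b\<in>carrier G. \<Sum>c\<in>carrier G. group_tensor G (a, b, c) * cnj (v (a, b, c)))"
    by (simp add: l2_inner_def sum.cartesian_product)
  also have "\<dots> = (\<Sum>a\<in>carrier G. \<Sum>b\<in>carrier G. cnj (v (a, b, inv (a \<otimes> b))))"
  proof (intro sum.cong refl)
    fix a b assume ab: "a \<in> carrier G" "b \<in> carrier G"
    have "a \<otimes> b \<otimes> c = \<one> \<longleftrightarrow> c = inv (a \<otimes> b)" if "c \<in> carrier G" for c
      using ab that by (metis inv_equality inv_inv m_closed r_inv inv_closed)
    then have "(\<Sum>c\<in>carrier G. group_tensor G (a, b, c) * cnj (v (a, b, c))) =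
        (\<Sum>c\<in>carrier G. if c = inv (a \<otimes> b) then cnj (v (a, b, inv (a \<otimes> b))) else 0)"
      using ab by (intro sum.cong) (auto simp: group_tensor_eq)
    then show "(\<Sum>c\<in>carrier G. group_tensor G (a, b, c) * cnj (v (a, b, c))) = cnj (v (a, b, inv (a \<otimes> b)))"
      using ab finite_carrier by simp
  qed
  finally show ?thesis .
qed

text \<open>For fixed a, the map from b to \<open>inv (a \<otimes> b)\<close> permutes the group, so
  Cauchy-Schwarz bounds the sum over b uniformly in a. What remains is the l1 norm of
  \<open>x\<close>, at most sqrt(n) times its l2 norm.\<close>

lemma group_tensor_inner_le:
  "cmod (l2_inner (carrier G \<times> carrier G \<times> carrier G) (group_tensor G) (tensor3 x y z)) \<le>
    sqrt (card (carrier G)) * l2_norm (carrier G) x * l2_norm (carrier G) y * l2_norm (carrier G) z"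
proof -
  let ?C = "carrier G"
  have "cmod (\<Sum>b\<in>?C. y b * z (inv (a \<otimes> b))) \<le> l2_norm ?C y * l2_norm ?C z" if a: "a \<in> ?C" for a
  proof -
    have "(\<Sum>b\<in>?C. (cmod (z (inv (a \<otimes> b))))\<^sup>2) = (\<Sum>b\<in>?C. (cmod (z b))\<^sup>2)"
      using sum_carrier_translate[OF a, of "\<lambda>b. (cmod (z (inv b)))\<^sup>2"]
        sum_carrier_inv[of "\<lambda>b. (cmod (z b))\<^sup>2"] by simp
    then show ?thesis using cauchy_schwarz[of y "\<lambda>b. z (inv (a \<otimes> b))" ?C] by (simp add: l2_norm_def)
  qed
  note yz = this
  have "l2_inner (?C \<times> ?C \<times> ?C) (group_tensor G) (tensor3 x y z) =
      cnj (\<Sum>a\<in>?C. x a * (\<Sum>b\<in>?C. y b * z (inv (a \<otimes> b))))"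
    unfolding l2_inner_group_tensor tensor3_def by (simp add: sum_distrib_left mult.assoc)
  then have "cmod (l2_inner (?C \<times> ?C \<times> ?C) (group_tensor G) (tensor3 x y z)) =
      cmod (\<Sum>a\<in>?C. x a * (\<Sum>b\<in>?C. y b * z (inv (a \<otimes> b))))"
    by (simp only: complex_mod_cnj)
  also have "\<dots> \<le> (\<Sum>a\<in>?C. cmod (x a) * (l2_norm ?C y * l2_norm ?C z))"
    using yz by (intro order_trans[OF norm_sum] sum_mono) (simp add: norm_mult mult_left_mono)
  also have "\<dots> = (\<Sum>a\<in>?C. \<bar>1\<bar> * \<bar>cmod (x a)\<bar>) * (l2_norm ?C y * l2_norm ?C z)"
    by (simp add: sum_distrib_right)
  also have "\<dots> \<le> L2_set (\<lambda>_. 1) ?C * l2_norm ?C x * (l2_norm ?C y * l2_norm ?C z)"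
    unfolding l2_norm_eq_L2_set[of ?C x] by (intro mult_right_mono L2_set_mult_ineq) simp
  also have "L2_set (\<lambda>_. 1) ?C = sqrt (card ?C)" by (simp add: L2_set_def)
  finally show ?thesis by (simp add: mult.assoc)
qed

lemma spectral_norm_group_tensor:
  "spectral_norm (carrier G) (carrier G) (carrier G) (group_tensor G) = sqrt (card (carrier G))"
  unfolding spectral_norm_def
proof (rule Greatest_equality)
  let ?C = "carrier G"
  let ?n = "real (card ?C)"
  have n: "?n > 0" using finite_carrier one_closed card_gt_0_iff by auto
  \<comment> \<open>This value gives the constant function norm 1. Each of the n^2 pairs (a, b)
    contributes s^3 to the pairing, and n^2 s^3 = sqrt(n).\<close>
  define s where "s = 1 / sqrt ?n"
  have s: "?n * s\<^sup>2 = 1" "s > 0" "?n * s = sqrt ?n"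
    using n by (simp_all add: s_def power_divide real_div_sqrt)
  define e where "e g = (if g \<in> ?C then complex_of_real s else 0)" for g
  have e: "e \<in> l2 ?C" by (simp add: e_def l2_def)
  have "l2_norm ?C e = 1"
    using s by (simp add: l2_norm_def e_def)
  then have norm: "l2_norm (?C \<times> ?C \<times> ?C) (tensor3 e e e) = 1" by (simp add: l2_norm_tensor3)
  have "l2_inner (?C \<times> ?C \<times> ?C) (group_tensor G) (tensor3 e e e) =
      (\<Sum>a\<in>?C. \<Sum>b\<in>?C. complex_of_real (s * s * s))"
    unfolding l2_inner_group_tensor
    by (intro sum.cong refl) (simp add: tensor3_def e_def)
  also have "\<dots> = complex_of_real (?n * s * (?n * s\<^sup>2))" by (simp add: power2_eq_square mult_ac)
  finally have "cmod (l2_inner (?C \<times> ?C \<times> ?C) (group_tensor G) (tensor3 e e e)) = sqrt ?n"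
    unfolding s norm_of_real by simp
  then show "\<exists>u\<in>pure_tensors ?C ?C ?C. l2_norm (?C \<times> ?C \<times> ?C) u = 1 \<and>
      sqrt ?n = cmod (l2_inner (?C \<times> ?C \<times> ?C) (group_tensor G) u)"
    using norm e unfolding pure_tensors_def by (intro bexI[of _ "tensor3 e e e"]) auto
next
  let ?C = "carrier G"
  fix r assume "\<exists>u\<in>pure_tensors ?C ?C ?C. l2_norm (?C \<times> ?C \<times> ?C) u = 1 \<and>
      r = cmod (l2_inner (?C \<times> ?C \<times> ?C) (group_tensor G) u)"
  then obtain x y z where "l2_norm (?C \<times> ?C \<times> ?C) (tensor3 x y z) = 1"
    "r = cmod (l2_inner (?C \<times> ?C \<times> ?C) (group_tensor G) (tensor3 x y z))"
    by (auto simp: pure_tensors_def)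
  then show "r \<le> sqrt (card ?C)"
    using group_tensor_inner_le[of x y z] by (simp add: l2_norm_tensor3 mult.assoc)
qed

end

section \<open>The norms of the group tensor\<close>

text \<open>The list of irreducibles after passage to unitary forms. Completeness is stated against
  unitary irreducibles, the class on which \<open>sum_dim_character\<close> tests it.\<close>

locale unitary_dual = finite_group +
  fixes I :: "'i set" and d :: "'i \<Rightarrow> nat" and U :: "'i \<Rightarrow> 'a \<Rightarrow> complex mat"
  assumes finite_I: "finite I"
    and irrep: "i \<in> I \<Longrightarrow> unitary_irrep (d i) (U i)"
    and distinct: "i \<in> I \<Longrightarrow> j \<in> I \<Longrightarrow> i \<noteq> j \<Longrightarrow>
      \<not> isomorphic_representations G (d i) (U i) (d j) (U j)"
    and complete: "unitary_irrep e \<tau> \<Longrightarrow> \<exists>i\<in>I. isomorphic_representations G e \<tau> (d i) (U i)"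
begin

abbreviation n :: real where "n \<equiv> real (card (carrier G))"

lemma n_pos: "n > 0"
  using finite_carrier one_closed card_gt_0_iff by auto

lemma d_pos: "i \<in> I \<Longrightarrow> d i > 0"
  using irreducibleD(2)[OF unitary_irrepD(1)[OF irrep]] .

lemma U_carrier: "i \<in> I \<Longrightarrow> g \<in> carrier G \<Longrightarrow> U i g \<in> carrier_mat (d i) (d i)"
  using representationD(1)[OF unitary_irrepD(2)[OF irrep]] .

text \<open>The factor is the reciprocal of the norm sqrt(n / d i) that Schur orthogonality assigns
  to a coefficient; the value 0 off the carrier is what membership in \<open>l2\<close>
  demands.\<close>

definition u :: "'i \<Rightarrow> nat \<Rightarrow> nat \<Rightarrow> 'a \<Rightarrow> complex" where
  "u i p q g = (if g \<in> carrier G then complex_of_real (sqrt (d i / n)) * U i g $$ (p, q) else 0)"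

lemma u_in_l2: "u i p q \<in> l2 (carrier G)"
  by (simp add: u_def l2_def)

lemma u_orthonormal:
  assumes i: "i \<in> I" "p < d i" "q < d i" and j: "j \<in> I" "p' < d j" "q' < d j"
  shows "l2_inner (carrier G) (u i p q) (u j p' q') = (if i = j \<and> p = p' \<and> q = q' then 1 else 0)"
proof -
  have "l2_inner (carrier G) (u i p q) (u j p' q') =
      complex_of_real (sqrt (d i / n) * sqrt (d j / n)) *
        (\<Sum>g\<in>carrier G. U i g $$ (p, q) * U j (inv g) $$ (q', p'))"
    unfolding l2_inner_def sum_distrib_left
  proof (rule sum.cong[OF refl])
    fix g assume g: "g \<in> carrier G"
    have "cnj (U j g $$ (p', q')) = U j (inv g) $$ (q', p')"
      using unitary_irrepD(3)[OF irrep[OF j(1)] g] U_carrier[OF j(1) g] j by auto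
    then show "u i p q g * cnj (u j p' q' g) =
        complex_of_real (sqrt (d i / n) * sqrt (d j / n)) * (U i g $$ (p, q) * U j (inv g) $$ (q', p'))"
      using g by (simp add: u_def)
  qed
  also have "\<dots> = (if i = j \<and> p = p' \<and> q = q' then 1 else 0)"
  proof (cases "i = j")
    case True
    have "(\<Sum>g\<in>carrier G. U i g $$ (p, q) * U j (inv g) $$ (q', p')) =
        (if p = p' \<and> q = q' then of_nat (card (carrier G)) / of_nat (d i) else 0)"
      using schur_orthogonality[OF unitary_irrepD(1)[OF irrep[OF i(1)]], of p q q' p'] i j True by auto
    moreover have "sqrt (d i / n) * sqrt (d i / n) = d i / n" by simp
    moreover have "complex_of_real (d i / n) * (of_nat (card (carrier G)) / of_nat (d i)) = 1"
      using n_pos d_pos[OF i(1)] by simp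
    ultimately show ?thesis using True n_pos d_pos[OF i(1)] by auto
  next
    case False
    then show ?thesis
      using schur_orthogonality_nonisomorphic[OF unitary_irrepD(1)[OF irrep[OF j(1)]]
          unitary_irrepD(1)[OF irrep[OF i(1)]] distinct[OF j(1) i(1)], of p q q' p'] i j
      by auto
  qed
  finally show ?thesis .
qed

lemma l2_norm_u: "i \<in> I \<Longrightarrow> p < d i \<Longrightarrow> q < d i \<Longrightarrow> l2_norm (carrier G) (u i p q) = 1"
proof -
  assume "i \<in> I" "p < d i" "q < d i"
  then have "complex_of_real ((l2_norm (carrier G) (u i p q))\<^sup>2) = complex_of_real 1"
    unfolding l2_inner_self[symmetric] by (simp add: u_orthonormal)
  then have "(l2_norm (carrier G) (u i p q))\<^sup>2 = 1" by (simp only: of_real_eq_iff)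
  then show ?thesis by (simp add: power2_eq_1_iff) (metis l2_norm_nonneg not_one_le_zero neg_0_le_iff_le)
qed

lemma bessel_u:
  "(\<Sum>i\<in>I. \<Sum>p<d i. \<Sum>q<d i. (cmod (l2_inner (carrier G) x (u i p q)))\<^sup>2) \<le> (l2_norm (carrier G) x)\<^sup>2"
proof -
  let ?J = "Sigma I (\<lambda>i. {..<d i} \<times> {..<d i})"
  have "(\<Sum>i\<in>I. \<Sum>p<d i. \<Sum>q<d i. (cmod (l2_inner (carrier G) x (u i p q)))\<^sup>2) =
      (\<Sum>(i, p, q)\<in>?J. (cmod (l2_inner (carrier G) x (u i p q)))\<^sup>2)"
    using finite_I by (simp add: sum.Sigma sum.cartesian_product)
  also have "\<dots> = (\<Sum>t\<in>?J. (cmod (l2_inner (carrier G) x ((\<lambda>(i, p, q). u i p q) t)))\<^sup>2)"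
    by (intro sum.cong) auto
  also have "\<dots> \<le> (l2_norm (carrier G) x)\<^sup>2"
    using finite_I by (intro bessel) (auto simp: u_orthonormal split: if_splits)
  finally show ?thesis .
qed

text \<open>The cyclic index pattern multiplies the three matrices and takes the trace; the three
  normalising factors combine to (d i / n)^(3/2).\<close>

lemma trace_u:
  assumes i: "i \<in> I" and abc: "a \<in> carrier G" "b \<in> carrier G" "c \<in> carrier G"
  shows "(\<Sum>p<d i. \<Sum>q<d i. \<Sum>r<d i. u i p q a * u i q r b * u i r p c) =
    complex_of_real (d i / n * sqrt (d i / n)) * (\<Sum>p<d i. U i (a \<otimes> b \<otimes> c) $$ (p, p))"
proof -
  note rep = unitary_irrepD(2)[OF irrep[OF i]]
  note ab = m_closed[OF abc(1,2)]
  let ?s = "complex_of_real (sqrt (d i / n))"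
  have s: "?s * ?s * ?s = complex_of_real (d i / n * sqrt (d i / n))"
    by (simp only: of_real_mult[symmetric]) simp
  have "(\<Sum>p<d i. \<Sum>q<d i. \<Sum>r<d i. u i p q a * u i q r b * u i r p c) =
      ?s * ?s * ?s * (\<Sum>p<d i. \<Sum>q<d i. \<Sum>r<d i. U i a $$ (p, q) * U i b $$ (q, r) * U i c $$ (r, p))"
    unfolding sum_distrib_left
    by (intro sum.cong refl) (simp only: u_def abc if_True mult_ac)
  also have "(\<Sum>p<d i. \<Sum>q<d i. \<Sum>r<d i. U i a $$ (p, q) * U i b $$ (q, r) * U i c $$ (r, p)) =
      (\<Sum>p<d i. \<Sum>r<d i. (\<Sum>q<d i. U i a $$ (p, q) * U i b $$ (q, r)) * U i c $$ (r, p))"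
    unfolding sum_distrib_right by (intro sum.cong refl sum.swap)
  also have "\<dots> = (\<Sum>p<d i. \<Sum>r<d i. U i (a \<otimes> b) $$ (p, r) * U i c $$ (r, p))"
    unfolding representationD(3)[OF rep abc(1,2)]
    by (intro sum.cong refl) (simp only: mult_mat_index[OF U_carrier[OF i abc(1)] U_carrier[OF i abc(2)]] lessThan_iff)
  also have "\<dots> = (\<Sum>p<d i. U i (a \<otimes> b \<otimes> c) $$ (p, p))"
    unfolding representationD(3)[OF rep ab abc(3)]
    by (intro sum.cong refl) (simp only: mult_mat_index[OF U_carrier[OF i ab] U_carrier[OF i abc(3)]] lessThan_iff)
  finally show ?thesis unfolding s .
qed

text \<open>The weight lowers (d i / n)^(3/2) to d i / n, so the right side is 1/n times the regular
  character at the product of the three entries. Putting the weight into the first factor keeps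
  every term a pure tensor.\<close>

lemma group_tensor_decomposition:
  "group_tensor G t = (\<Sum>i\<in>I. \<Sum>p<d i. \<Sum>q<d i. \<Sum>r<d i.
     tensor3 (\<lambda>g. complex_of_real (sqrt (n / d i)) * u i p q g) (u i q r) (u i r p) t)"
proof (cases t)
  case (fields a b c)
  show ?thesis
  proof (cases "a \<in> carrier G \<and> b \<in> carrier G \<and> c \<in> carrier G")
    case True
    then have abc: "a \<in> carrier G" "b \<in> carrier G" "c \<in> carrier G" by auto
    have "(\<Sum>i\<in>I. \<Sum>p<d i. \<Sum>q<d i. \<Sum>r<d i.
        tensor3 (\<lambda>g. complex_of_real (sqrt (n / d i)) * u i p q g) (u i q r) (u i r p) t) =
        (\<Sum>i\<in>I. complex_of_real (sqrt (n / d i)) *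
          (\<Sum>p<d i. \<Sum>q<d i. \<Sum>r<d i. u i p q a * u i q r b * u i r p c))"
      unfolding fields tensor3_def sum_distrib_left by (simp add: mult.assoc)
    also have "\<dots> = (\<Sum>i\<in>I. complex_of_real (1 / n) *
        (of_nat (d i) * (\<Sum>p<d i. U i (a \<otimes> b \<otimes> c) $$ (p, p))))"
    proof (rule sum.cong[OF refl])
      fix i assume i: "i \<in> I"
      have "sqrt (n / d i) * sqrt (d i / n) = 1"
        using n_pos d_pos[OF i] by (simp flip: real_sqrt_mult)
      then have "sqrt (n / d i) * (d i / n * sqrt (d i / n)) = 1 / n * d i"
        by (simp add: mult_ac)
      from arg_cong[OF this, of complex_of_real]
      have "complex_of_real (sqrt (n / d i)) * complex_of_real (d i / n * sqrt (d i / n)) =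
          complex_of_real (1 / n) * of_nat (d i)"
        by (simp only: of_real_mult of_real_of_nat_eq)
      then show "complex_of_real (sqrt (n / d i)) * (\<Sum>p<d i. \<Sum>q<d i. \<Sum>r<d i. u i p q a * u i q r b * u i r p c) =
          complex_of_real (1 / n) * (of_nat (d i) * (\<Sum>p<d i. U i (a \<otimes> b \<otimes> c) $$ (p, p)))"
        unfolding trace_u[OF i abc] by (simp only: mult.assoc[symmetric])
    qed
    also have "\<dots> = complex_of_real (1 / n) * (if a \<otimes> b \<otimes> c = \<one> then of_nat (card (carrier G)) else 0)"
      unfolding sum_distrib_left[symmetric] using abc
      by (subst sum_dim_character[OF irrep finite_I distinct complete]) auto
    also have "\<dots> = group_tensor G t"
      unfolding fields group_tensor_eq using abc n_pos by auto
    finally show ?thesis by simp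
  next
    case False
    then show ?thesis unfolding fields group_tensor_eq tensor3_def by (auto simp: u_def)
  qed
qed

section \<open>The dual certificate and the nuclear norm\<close>

definition dual_tensor :: "'a \<times> 'a \<times> 'a \<Rightarrow> complex" where
  "dual_tensor t = (\<Sum>i\<in>I. \<Sum>p<d i. \<Sum>q<d i. \<Sum>r<d i. tensor3 (u i p q) (u i q r) (u i r p) t)"

text \<open>On a pure tensor the pairing is a sum over blocks of traces of products of three Fourier
  coefficient matrices, and Bessel's inequality bounds each family by the norm of its tensor
  factor.\<close>

lemma l2_inner_dual_tensor_le:
  assumes "v \<in> pure_tensors (carrier G) (carrier G) (carrier G)"
  shows "cmod (l2_inner (carrier G \<times> carrier G \<times> carrier G) v dual_tensor) \<le> l2_norm (carrier G \<times> carrier G \<times> carrier G) v"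
proof -
  obtain x y z where v: "v = tensor3 x y z" using assms by (auto simp: pure_tensors_def)
  have "l2_inner (carrier G \<times> carrier G \<times> carrier G) v dual_tensor =
     (\<Sum>i\<in>I. \<Sum>p<d i. \<Sum>q<d i. \<Sum>r<d i. l2_inner (carrier G) x (u i p q) *
        l2_inner (carrier G) y (u i q r) * l2_inner (carrier G) z (u i r p))"
    unfolding dual_tensor_def v l2_inner_sum_right l2_inner_tensor3 ..
  then show ?thesis
    unfolding v l2_norm_tensor3 using block_trilinear_bound[OF finite_I bessel_u l2_norm_nonneg bessel_u
      l2_norm_nonneg bessel_u l2_norm_nonneg] by simp
qed

text \<open>The first left side is the share of block i in the pairing of T_G with
  \<open>dual_tensor\<close>, the second its share in the total norm of the decomposition. Their
  agreement closes the duality gap.\<close>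

lemma dim_scaling:
  assumes "i \<in> I"
  shows "d i / n * sqrt (d i / n) * d i * n\<^sup>2 = sqrt n * d i powr (5/2)"
    and "sqrt (n / d i) * (d i) ^ 3 = sqrt n * d i powr (5/2)"
proof -
  have d: "real (d i) > 0" using d_pos[OF assms] by simp
  have "real (d i) powr (5/2) = real (d i) powr (2 + 1/2)" by simp
  also have "\<dots> = (d i)\<^sup>2 * sqrt (d i)"
    unfolding powr_add using d by (simp add: powr_half_sqrt)
  finally have p: "real (d i) powr (5/2) = (d i)\<^sup>2 * sqrt (d i)" .
  have "n = sqrt n * sqrt n" and "real (d i) = sqrt (d i) * sqrt (d i)" using n_pos by simp_all
  then show "d i / n * sqrt (d i / n) * d i * n\<^sup>2 = sqrt n * d i powr (5/2)"
    and "sqrt (n / d i) * (d i) ^ 3 = sqrt n * d i powr (5/2)"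
    unfolding p using n_pos d
    by (simp_all add: real_sqrt_divide power2_eq_square power3_eq_cube divide_simps)
qed

text \<open>On the support of T_G the product of the three entries is \<open>\<one>\<close>, so
  every trace equals d i and \<open>dual_tensor\<close> is constant there; the pairing adds this
  constant over n^2 pairs.\<close>

lemma l2_inner_group_tensor_dual_tensor:
  "l2_inner (carrier G \<times> carrier G \<times> carrier G) (group_tensor G) dual_tensor =
    complex_of_real (sqrt n * (\<Sum>i\<in>I. d i powr (5/2)))"
proof -
  let ?s = "\<lambda>i. complex_of_real (d i / n * sqrt (d i / n))"
  have "cnj (dual_tensor (a, b, inv (a \<otimes> b))) = (\<Sum>i\<in>I. ?s i * of_nat (d i))" if ab: "a \<in> carrier G" "b \<in> carrier G" for a b
  proof -
    have c: "inv (a \<otimes> b) \<in> carrier G" using ab by simp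
    have "dual_tensor (a, b, inv (a \<otimes> b)) = (\<Sum>i\<in>I. \<Sum>p<d i. \<Sum>q<d i. \<Sum>r<d i. u i p q a * u i q r b * u i r p (inv (a \<otimes> b)))"
      by (simp add: dual_tensor_def tensor3_def)
    also have "\<dots> = (\<Sum>i\<in>I. ?s i * of_nat (d i))"
    proof (rule sum.cong[OF refl])
      fix i assume i: "i \<in> I"
      have "a \<otimes> b \<otimes> inv (a \<otimes> b) = \<one>" using ab by simp
      then show "(\<Sum>p<d i. \<Sum>q<d i. \<Sum>r<d i. u i p q a * u i q r b * u i r p (inv (a \<otimes> b))) = ?s i * of_nat (d i)"
        unfolding trace_u[OF i ab c] using representationD(2)[OF unitary_irrepD(2)[OF irrep[OF i]]] by simp
    qed
    finally show ?thesis by (simp add: cnj_sum)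
  qed
  then have "l2_inner (carrier G \<times> carrier G \<times> carrier G) (group_tensor G) dual_tensor =
      (\<Sum>a\<in>carrier G. \<Sum>b\<in>carrier G. \<Sum>i\<in>I. ?s i * of_nat (d i))"
    unfolding l2_inner_group_tensor by simp
  also have "\<dots> = complex_of_real (n * (n * (\<Sum>i\<in>I. d i / n * sqrt (d i / n) * d i)))"
    by simp
  also have "n * (n * (\<Sum>i\<in>I. d i / n * sqrt (d i / n) * d i)) = (\<Sum>i\<in>I. d i / n * sqrt (d i / n) * d i * n\<^sup>2)"
    unfolding sum_distrib_left by (intro sum.cong refl) (simp only: power2_eq_square mult_ac)
  also have "\<dots> = sqrt n * (\<Sum>i\<in>I. d i powr (5/2))"
    unfolding sum_distrib_left by (intro sum.cong refl dim_scaling)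
  finally show ?thesis .
qed

lemma nuclear_norm_group_tensor:
  "nuclear_norm (carrier G) (carrier G) (carrier G) (group_tensor G) = sqrt n * (\<Sum>i\<in>I. d i powr (5/2))"
  unfolding nuclear_norm_def
proof (rule Least_equality)
  let ?C = "carrier G"
  let ?J = "Sigma I (\<lambda>i. {..<d i} \<times> {..<d i} \<times> {..<d i})"
  let ?N = "card ?J"
  define w where "w = (\<lambda>(i, p, q, r). tensor3 (\<lambda>g. complex_of_real (sqrt (n / d i)) * u i p q g) (u i q r) (u i r p))"
  have J: "finite ?J" using finite_I by blast
  have flat: "(\<Sum>i\<in>I. \<Sum>p<d i. \<Sum>q<d i. \<Sum>r<d i. F i p q r) = (\<Sum>(i, p, q, r)\<in>?J. F i p q r)"
    for F :: "'i \<Rightarrow> nat \<Rightarrow> nat \<Rightarrow> nat \<Rightarrow> 'c::comm_monoid_add"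
    using finite_I by (simp add: sum.Sigma sum.cartesian_product)
  have T: "group_tensor G = (\<lambda>t. \<Sum>j\<in>?J. w j t)"
    by (rule ext, subst group_tensor_decomposition) (simp add: flat w_def case_prod_unfold)
  have pure: "w j \<in> pure_tensors ?C ?C ?C" for j
  proof -
    obtain i p q r where j: "j = (i, p, q, r)" by (cases j)
    have "(\<lambda>g. complex_of_real (sqrt (n / d i)) * u i p q g) \<in> l2 ?C" by (simp add: l2_def u_def)
    then show ?thesis unfolding w_def j prod.case pure_tensors_def using u_in_l2 by blast
  qed
  have "(\<Sum>j\<in>?J. l2_norm (?C \<times> ?C \<times> ?C) (w j)) =
      (\<Sum>i\<in>I. \<Sum>p<d i. \<Sum>q<d i. \<Sum>r<d i. l2_norm (?C \<times> ?C \<times> ?C) (w (i, p, q, r)))"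
    unfolding flat by (simp add: case_prod_unfold)
  also have "\<dots> = (\<Sum>i\<in>I. \<Sum>p<d i. \<Sum>q<d i. \<Sum>r<d i. sqrt (n / d i))"
  proof (intro sum.cong refl)
    fix i p q r assume i: "i \<in> I" "p \<in> {..<d i}" "q \<in> {..<d i}" "r \<in> {..<d i}"
    show "l2_norm (?C \<times> ?C \<times> ?C) (w (i, p, q, r)) = sqrt (n / d i)"
      using i by (simp add: w_def l2_norm_tensor3 l2_norm_scale l2_norm_u)
  qed
  also have "\<dots> = (\<Sum>i\<in>I. sqrt (n / d i) * (d i) ^ 3)"
    by (intro sum.cong refl) (simp add: power3_eq_cube)
  also have "\<dots> = sqrt n * (\<Sum>i\<in>I. d i powr (5/2))"
    unfolding sum_distrib_left by (intro sum.cong refl dim_scaling)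
  finally have norm: "(\<Sum>j\<in>?J. l2_norm (?C \<times> ?C \<times> ?C) (w j)) = sqrt n * (\<Sum>i\<in>I. d i powr (5/2))" .
  \<comment> \<open>Decompositions in \<open>nuclear_norm\<close> are indexed by an initial segment
    of the natural numbers, so the quadruples are enumerated.\<close>
  obtain f where f: "bij_betw f {..<?N} ?J"
    using ex_bij_betw_nat_finite[OF J] unfolding atLeast0LessThan by (rule exE)
  show "\<exists>(m::nat) v. (\<forall>i<m. v i \<in> pure_tensors ?C ?C ?C) \<and> group_tensor G = (\<lambda>t. \<Sum>i<m. v i t) \<and>
      sqrt n * (\<Sum>i\<in>I. d i powr (5/2)) = (\<Sum>i<m. l2_norm (?C \<times> ?C \<times> ?C) (v i))"
  proof (intro exI[of _ ?N] exI[of _ "\<lambda>k. w (f k)"] conjI allI impI)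
    show "w (f k) \<in> pure_tensors ?C ?C ?C" for k by (rule pure)
    show "group_tensor G = (\<lambda>t. \<Sum>k<?N. w (f k) t)"
      unfolding T by (rule ext) (rule sum.reindex_bij_betw[OF f, symmetric])
    show "sqrt n * (\<Sum>i\<in>I. d i powr (5/2)) = (\<Sum>k<?N. l2_norm (?C \<times> ?C \<times> ?C) (w (f k)))"
      unfolding norm[symmetric] by (rule sum.reindex_bij_betw[OF f, symmetric])
  qed
next
  let ?C = "carrier G"
  fix r assume "\<exists>(m::nat) v. (\<forall>i<m. v i \<in> pure_tensors ?C ?C ?C) \<and> group_tensor G = (\<lambda>t. \<Sum>i<m. v i t) \<and>
      r = (\<Sum>i<m. l2_norm (?C \<times> ?C \<times> ?C) (v i))"
  then obtain m :: nat and v where v: "\<And>i. i < m \<Longrightarrow> v i \<in> pure_tensors ?C ?C ?C"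
    and T: "group_tensor G = (\<lambda>t. \<Sum>i<m. v i t)" and r: "r = (\<Sum>i<m. l2_norm (?C \<times> ?C \<times> ?C) (v i))"
    by blast
  \<comment> \<open>The pairing is a nonnegative real, so its modulus loses nothing; the triangle
    inequality and the dual bound, term by term, then limit it by the total norm of any
    decomposition.\<close>
  have "sqrt n * (\<Sum>i\<in>I. d i powr (5/2)) = cmod (l2_inner (?C \<times> ?C \<times> ?C) (group_tensor G) dual_tensor)"
    unfolding l2_inner_group_tensor_dual_tensor norm_of_real by (simp add: sum_nonneg)
  also have "\<dots> = cmod (\<Sum>i<m. l2_inner (?C \<times> ?C \<times> ?C) (v i) dual_tensor)"
    by (subst T) (simp only: l2_inner_sum_left)
  also have "\<dots> \<le> r"
    unfolding r by (rule order_trans[OF norm_sum]) (intro sum_mono l2_inner_dual_tensor_le v, simp)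
  finally show "sqrt n * (\<Sum>i\<in>I. d i powr (5/2)) \<le> r" .
qed

end

theorem corollary1p12:
  fixes G :: "('a, 'm) monoid_scheme"
    and n s :: nat
    and d :: "nat \<Rightarrow> nat"
    and \<rho> :: "nat \<Rightarrow> 'a \<Rightarrow> complex mat"
  assumes "group G" and "finite (carrier G)" and "Coset.order G = n"
    and irreducible: "\<And>i. i \<in> {1..s} \<Longrightarrow> irreducible_representation G (d i) (\<rho> i)"
    and distinct: "\<And>i j. i \<in> {1..s} \<Longrightarrow> j \<in> {1..s} \<Longrightarrow> i \<noteq> j \<Longrightarrow>
        \<not> isomorphic_representations G (d i) (\<rho> i) (d j) (\<rho> j)"
    and complete: "\<And>e \<sigma>. irreducible_representation G e \<sigma> \<Longrightarrow>
        \<exists>i\<in>{1..s}. isomorphic_representations G e \<sigma> (d i) (\<rho> i)"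
  shows "nuclear_norm (carrier G) (carrier G) (carrier G) (group_tensor G) =
           sqrt (real n) * (\<Sum>i=1..s. real (d i) powr (5/2)) \<and>
         spectral_norm (carrier G) (carrier G) (carrier G) (group_tensor G) = sqrt (real n)"
proof -
  interpret G: finite_group G
    by (intro finite_group.intro finite_group_axioms.intro assms)
  have n: "n = card (carrier G)" using assms(3) by (simp add: Coset.order_def)
  \<comment> \<open>Each unitary form has the dimension of the representation it replaces, so the
    dimensions in the formula remain the given ones.\<close>
  have "\<forall>i. \<exists>\<tau>. i \<in> {1..s} \<longrightarrow>
      G.unitary_irrep (d i) \<tau> \<and> isomorphic_representations G (d i) (\<rho> i) (d i) \<tau>"
    using G.irreducible_isomorphic_unitary[OF irreducible] by metis
  then obtain U where U: "\<And>i. i \<in> {1..s} \<Longrightarrow> G.unitary_irrep (d i) (U i)"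
    and iso: "\<And>i. i \<in> {1..s} \<Longrightarrow> isomorphic_representations G (d i) (\<rho> i) (d i) (U i)"
    by metis
  note rep = G.irreducibleD(1)[OF irreducible] and repU = G.unitary_irrepD(2)[OF U]
  interpret unitary_dual G "{1..s}" d U
  proof
    fix i j assume i: "i \<in> {1..s}" and j: "j \<in> {1..s}" and ij: "i \<noteq> j"
    show "\<not> isomorphic_representations G (d i) (U i) (d j) (U j)"
    proof
      assume "isomorphic_representations G (d i) (U i) (d j) (U j)"
      then have "isomorphic_representations G (d i) (\<rho> i) (d j) (U j)"
        by (rule G.isomorphic_trans[OF iso[OF i] _ rep[OF i] repU[OF i] repU[OF j]])
      then have "isomorphic_representations G (d i) (\<rho> i) (d j) (\<rho> j)"
        by (rule G.isomorphic_trans[OF _ G.isomorphic_sym[OF iso[OF j] rep[OF j] repU[OF j]]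
            rep[OF i] repU[OF j] rep[OF j]])
      then show False using distinct[OF i j ij] by contradiction
    qed
  next
    fix e \<tau> assume \<tau>: "G.unitary_irrep e \<tau>"
    obtain i where i: "i \<in> {1..s}" "isomorphic_representations G e \<tau> (d i) (\<rho> i)"
      using complete[OF G.unitary_irrepD(1)[OF \<tau>]] by blast
    have "isomorphic_representations G e \<tau> (d i) (U i)"
      by (rule G.isomorphic_trans[OF i(2) iso[OF i(1)] G.unitary_irrepD(2)[OF \<tau>] rep[OF i(1)] repU[OF i(1)]])
    then show "\<exists>i\<in>{1..s}. isomorphic_representations G e \<tau> (d i) (U i)" using i(1) by blast
  qed (use U in auto)
  show ?thesis
    using nuclear_norm_group_tensor G.spectral_norm_group_tensor by (simp add: n)
qed

end
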